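(* Consider the system with continuous control only, and let the feasible policy space be the ball $\mathfrak C=\{\pi^u\mid d(\pi^u,\pi_0^u)\le\rho\}$ of radius $\rho$ centered at a given lifted continuous control policy $\pi_0^u\in\Pi^u(\boldsymbol w)$. Suppose that the cost functions $c_t(\boldsymbol x_t,\boldsymbol u_t)$ are Lipschitz continuous with Lipschitz constant $L_c$. Then $$J^\ast(\Pi^u_{L_\pi}(\boldsymbol w))-J^\ast(\mathfrak N^u_{L_\pi})\lesssim\mathcal O(\epsilon(\boldsymbol w)),$$ i.e. there is a constant $C$, independent of $\boldsymbol w$ (depending only on the horizon, the dimensions, the system matrices, $L_c$ and $L_\pi$), with $J^\ast(\Pi^u_{L_\pi}(\boldsymbol w))\le J^\ast(\mathfrak N^u_{L_\pi})+C\,\epsilon(\boldsymbol w)$. This bound is tight: for any $L_c,L_\pi>0$ there exist a system (horizon, dimensions, matrices, support) and a constant $c>0$ such that, for arbitrarily small $\epsilon>0$, there are breakpoints $\boldsymbol w$ with $\epsilon(\boldsymbol w)=\epsilon$, a center $\pi_0^u\in\Pi^u(\boldsymbol w)$, a radius $\rho$, an ambiguity set $\mathscr B$ and cost functions with Lipschitz constant $L_c$ satisfying all the hypotheses above for which $J^\ast(\Pi^u_{L_\pi}(\boldsymbol w))-J^\ast(\mathfrak N^u_{L_\pi})\ge c\,\epsilon(\boldsymbol w)$. As a consequence, if the breakpoints are selected to segment each dimension of the support into $n$ segments of equal length, then $\epsilon(\boldsymbol w)\lesssim\mathcal O(1/n)$ and $$J^\ast(\Pi^u_{L_\pi}(\boldsymbol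 w))-J^\ast(\mathfrak N^u_{L_\pi})\lesssim\mathcal O(1/n),$$ with implied constants independent of $n$.
   Context: **Notation.** $[N]=\{1,\dots,N\}$. $\mathcal{T}$ is a finite horizon. The disturbance is $\boldsymbol\xi=(\boldsymbol\xi_1,\dots,\boldsymbol\xi_{\mathcal T})$, $\boldsymbol\xi_t=(\xi_{t,1},\dots,\xi_{t,n_\xi})\in\mathbb{R}^{n_\xi}$, $\boldsymbol\xi_{[t]}=(\boldsymbol\xi_1,\dots,\boldsymbol\xi_t)$. Its support is the hyperrectangle $\varXi=\prod_{t,i}\varXi_{t,i}$, $\varXi_{t,i}=[l_{t,i},v_{t,i}]$ with $l_{t,i}<v_{t,i}$ real; $\varXi_{[t]}$ is the support of $\boldsymbol\xi_{[t]}$. All norms on vectors are 1-norms; in particular Lipschitz constants of $c_t$ and of policies (as functions of $\boldsymbol\xi_{[t]}\in\varXi_{[t]}$) are with respect to the 1-norm. **System and value.** $\boldsymbol x_{t+1}=\boldsymbol A_t\boldsymbol x_t+\boldsymbol B_t\boldsymbol u_t+\boldsymbol D_t\boldsymbol\xi_t$ for $t=0,\dots,\mathcal T-1$, with $\boldsymbol x_t\in\mathbb R^{n_x}$, $\boldsymbol u_t\in\mathbb R^{n_u}$, given matrices, given $\boldsymbol x_0$, and the convention $\boldsymbol u_0=0$, $\boldsymbol\xi_0=0$. A causal policy is $\pi^u=(\boldsymbol u_1^\pi(\cdot),\dots,\boldsymbol u_{\mathcal T}^\pi(\cdot))$ with $\boldsymbol u_t^\pi:\varXi_{[t]}\to\mathbb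 R^{n_u}$, components $u^\pi_{t,j}$, $j\in[n_u]$. $\mathscr B$ is a given nonempty set of Borel probability measures on $\varXi$ (the ambiguity set) and $\alpha^t\in[0,1]$ are given. For a set $\Pi$ of policies, $J^\ast(\Pi)=\inf_{\pi^u\in\Pi\cap\mathfrak C}\ \sup_{\mathbb P\in\mathscr B}\mathbb E_{\boldsymbol\xi\sim\mathbb P}\big[\sum_{t=1}^{\mathcal T}\alpha^tc_t(\boldsymbol x_t,\boldsymbol u_t^\pi)\big]$, where $\boldsymbol x_t$ are the states induced by $\pi^u$ (and $\inf\emptyset=+\infty$); membership in $\mathfrak C$ is the only feasibility constraint. **Breakpoints and lifted policies.** A breakpoint choice $\boldsymbol w$ consists of integers $p_{t,i}\ge1$ and reals $l_{t,i}=w_{t,i,0}\le w_{t,i,1}\le\dots\le w_{t,i,p_{t,i}}=v_{t,i}$ for all $t\in[\mathcal T],i\in[n_\xi]$. For $\xi_{t,i}\in\varXi_{t,i}$: $V_{t,i,1}=\min\{\xi_{t,i},w_{t,i,1}\}$, $V_{t,i,j}=\max\{\min\{\xi_{t,i},w_{t,i,j}\}-w_{t,i,j-1},0\}$ for $2\le j\le p_{t,i}$. Let $\boldsymbol V_{[t]}(\boldsymbol\xi_{[t]})$ stack all $V_{t',i,j}$ with $t'\le t$, $i\in[n_\xi]$, and let $n_{V_t}$ be its dimension. $\Pi^u(\boldsymbol w)$ is the set of $\pi^u$ with $\boldsymbol u_t^\pi(\boldsymbol\xi_{[t]})=\boldsymbol Y_t\boldsymbol V_{[t]}(\boldsymbol\xi_{[t]})+\boldsymbol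 y_t^0$, $\boldsymbol Y_t\in\mathbb R^{n_u\times n_{V_t}}$, $\boldsymbol y_t^0\in\mathbb R^{n_u}$, for all $t$. The largest segment is $\epsilon(\boldsymbol w)=\max_{t\in[\mathcal T],i\in[n_\xi],j\in[p_{t,i}]}(w_{t,i,j}-w_{t,i,j-1})$. **Additive and Lipschitz policies.** $\mathfrak N^u$ is the set of $\pi^u$ with, for all $t\in[\mathcal T],j\in[n_u]$, $u^\pi_{t,j}(\boldsymbol\xi_{[t]})=\sum_{t'=1}^t\sum_{i=1}^{n_\xi}f_{t,j,t',i}(\xi_{t',i})$, each $f_{t,j,t',i}$ continuous on $\varXi_{t',i}$. For $L_\pi\geq 0$, $\Pi^u_{L_\pi}(\boldsymbol w)$ (resp. $\mathfrak N^u_{L_\pi}$) is the set of $\pi^u\in\Pi^u(\boldsymbol w)$ (resp. $\pi^u\in\mathfrak N^u$) all of whose components $u^\pi_{t,j}$ are $L_\pi$-Lipschitz. The distance is $d(\pi_1^u,\pi_2^u)=\sum_{t=1}^{\mathcal T}\sum_{j=1}^{n_u}\|u^{\pi_1}_{t,j}-u^{\pi_2}_{t,j}\|_\infty$ (supremum norm on $\varXi_{[t]}$). *)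

theory Defs
  imports "HOL-Probability.Probability"
begin

text \<open>
  Horizons and dimensions are quantified inside the statement, so vectors and matrices are functions
  on natural-number indices, of which only the indices in \<open>{1..n}\<close> matter.  A disturbance (or a
  disturbance history) is a function on pairs \<open>(t, i)\<close> of a stage and a component.
\<close>

type_synonym rvec = "nat \<Rightarrow> real"
type_synonym rmat = "nat \<Rightarrow> nat \<Rightarrow> real"
type_synonym disturbance = "nat \<times> nat \<Rightarrow> real"
type_synonym policy = "nat \<Rightarrow> disturbance \<Rightarrow> rvec"
type_synonym cost = "nat \<Rightarrow> rvec \<Rightarrow> rvec \<Rightarrow> real"

record lin_system =
  horizon :: nat
  dim_x :: nat
  dim_u :: nat
  dim_xi :: nat
  Amat :: "nat \<Rightarrow> rmat"
  Bmat :: "nat \<Rightarrow> rmat"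
  Dmat :: "nat \<Rightarrow> rmat"

definition wf_system :: "lin_system \<Rightarrow> bool" where
  "wf_system S \<longleftrightarrow> 1 \<le> horizon S \<and> 1 \<le> dim_x S \<and> 1 \<le> dim_u S \<and> 1 \<le> dim_xi S"

definition norm1 :: "nat \<Rightarrow> rvec \<Rightarrow> real" where
  "norm1 n x = (\<Sum>i=1..n. \<bar>x i\<bar>)"

definition wf_support :: "lin_system \<Rightarrow> (nat \<Rightarrow> nat \<Rightarrow> real) \<Rightarrow> (nat \<Rightarrow> nat \<Rightarrow> real) \<Rightarrow> bool" where
  "wf_support S l v \<longleftrightarrow> (\<forall>t\<in>{1..horizon S}. \<forall>i\<in>{1..dim_xi S}. l t i < v t i)"

definition hist_index :: "lin_system \<Rightarrow> nat \<Rightarrow> (nat \<times> nat) set" where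
  "hist_index S t = {1..t} \<times> {1..dim_xi S}"

definition hist_support ::
    "lin_system \<Rightarrow> (nat \<Rightarrow> nat \<Rightarrow> real) \<Rightarrow> (nat \<Rightarrow> nat \<Rightarrow> real) \<Rightarrow> nat \<Rightarrow> disturbance set" where
  "hist_support S l v t = PiE (hist_index S t) (\<lambda>(t', i). {l t' i..v t' i})"

definition hist :: "lin_system \<Rightarrow> disturbance \<Rightarrow> nat \<Rightarrow> disturbance" where
  "hist S \<xi> t = restrict \<xi> (hist_index S t)"

text \<open>
  Causality is built in: the stage-\<open>t\<close> component of a policy is only ever applied to the history
  up to \<open>t\<close>.
\<close>

definition control :: "lin_system \<Rightarrow> policy \<Rightarrow> disturbance \<Rightarrow> nat \<Rightarrow> rvec" where
  "control S \<pi> \<xi> t = (if t = 0 then (\<lambda>_. 0) else \<pi> t (hist S \<xi> t))"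

definition noise :: "disturbance \<Rightarrow> nat \<Rightarrow> rvec" where
  "noise \<xi> t = (if t = 0 then (\<lambda>_. 0) else (\<lambda>i. \<xi> (t, i)))"

primrec state :: "lin_system \<Rightarrow> rvec \<Rightarrow> policy \<Rightarrow> disturbance \<Rightarrow> nat \<Rightarrow> rvec" where
  "state S x0 \<pi> \<xi> 0 = x0"
| "state S x0 \<pi> \<xi> (Suc t) = (\<lambda>i.
      (\<Sum>k=1..dim_x S. Amat S t i k * state S x0 \<pi> \<xi> t k)
    + (\<Sum>k=1..dim_u S. Bmat S t i k * control S \<pi> \<xi> t k)
    + (\<Sum>k=1..dim_xi S. Dmat S t i k * noise \<xi> t k))"

text \<open>
  The product sigma-algebra over a finite index set is the Borel sigma-algebra of the Euclidean
  space, so its restriction to the hyperrectangle is the Borel sigma-algebra of the support.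
\<close>

definition ambiguity_set ::
    "lin_system \<Rightarrow> (nat \<Rightarrow> nat \<Rightarrow> real) \<Rightarrow> (nat \<Rightarrow> nat \<Rightarrow> real) \<Rightarrow> disturbance measure set \<Rightarrow> bool" where
  "ambiguity_set S l v \<B> \<longleftrightarrow> \<B> \<noteq> {} \<and>
     (\<forall>P\<in>\<B>. prob_space P \<and>
        sets P = sets (restrict_space (PiM (hist_index S (horizon S)) (\<lambda>_. borel))
                                      (hist_support S l v (horizon S))))"

text \<open>
  For costs, Lipschitz continuity also forces \<open>c t x u\<close> to depend only on the components of \<open>x\<close> and
  \<open>u\<close> that belong to the respective space.
\<close>

definition lipschitz_cost :: "lin_system \<Rightarrow> real \<Rightarrow> cost \<Rightarrow> bool" where
  "lipschitz_cost S Lc c \<longleftrightarrow> (\<forall>t\<in>{1..horizon S}. \<forall>x u x' u'.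
     \<bar>c t x u - c t x' u'\<bar>
       \<le> Lc * (norm1 (dim_x S) (\<lambda>i. x i - x' i) + norm1 (dim_u S) (\<lambda>j. u j - u' j)))"

text \<open>
  This is only used for classes of policies that are continuous on the compact support and for
  Lipschitz costs, so the integrand is bounded and measurable and the integral is the expectation.
  The infimum over the empty set is \<open>\<infinity>\<close>.
\<close>

definition optimal_value ::
    "lin_system \<Rightarrow> rvec \<Rightarrow> (nat \<Rightarrow> real) \<Rightarrow> cost \<Rightarrow> disturbance measure set \<Rightarrow> policy set
      \<Rightarrow> policy set \<Rightarrow> ereal" where
  "optimal_value S x0 \<alpha> c \<B> \<CC> Pol =
     (INF \<pi>\<in>Pol \<inter> \<CC>. SUP P\<in>\<B>.
        ereal (\<integral>\<xi>. (\<Sum>t=1..horizon S. \<alpha> t * c t (state S x0 \<pi> \<xi> t) (control S \<pi> \<xi> t)) \<partial>P))"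

text \<open>
  A breakpoint choice is a pair of families \<open>p t i\<close> (number of segments) and \<open>w t i k\<close> (breakpoints,
  \<open>k \<in> {0..p t i}\<close>).
\<close>

definition breakpoints ::
    "lin_system \<Rightarrow> (nat \<Rightarrow> nat \<Rightarrow> real) \<Rightarrow> (nat \<Rightarrow> nat \<Rightarrow> real) \<Rightarrow> (nat \<Rightarrow> nat \<Rightarrow> nat)
      \<Rightarrow> (nat \<Rightarrow> nat \<Rightarrow> nat \<Rightarrow> real) \<Rightarrow> bool" where
  "breakpoints S l v p w \<longleftrightarrow> (\<forall>t\<in>{1..horizon S}. \<forall>i\<in>{1..dim_xi S}.
     1 \<le> p t i \<and> w t i 0 = l t i \<and> w t i (p t i) = v t i \<and>
     (\<forall>k\<in>{1..p t i}. w t i (k - 1) \<le> w t i k))"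

definition largest_segment ::
    "lin_system \<Rightarrow> (nat \<Rightarrow> nat \<Rightarrow> nat) \<Rightarrow> (nat \<Rightarrow> nat \<Rightarrow> nat \<Rightarrow> real) \<Rightarrow> real" where
  "largest_segment S p w =
     Max {w t i k - w t i (k - 1) | t i k.
            t \<in> {1..horizon S} \<and> i \<in> {1..dim_xi S} \<and> k \<in> {1..p t i}}"

definition equal_segments ::
    "lin_system \<Rightarrow> (nat \<Rightarrow> nat \<Rightarrow> real) \<Rightarrow> (nat \<Rightarrow> nat \<Rightarrow> real) \<Rightarrow> nat \<Rightarrow> (nat \<Rightarrow> nat \<Rightarrow> nat)
      \<Rightarrow> (nat \<Rightarrow> nat \<Rightarrow> nat \<Rightarrow> real) \<Rightarrow> bool" where
  "equal_segments S l v n p w \<longleftrightarrow> (\<forall>t\<in>{1..horizon S}. \<forall>i\<in>{1..dim_xi S}.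
     p t i = n \<and> (\<forall>k\<in>{1..n}. w t i k - w t i (k - 1) = (v t i - l t i) / real n))"

definition lifting :: "(nat \<Rightarrow> nat \<Rightarrow> nat \<Rightarrow> real) \<Rightarrow> nat \<Rightarrow> nat \<Rightarrow> nat \<Rightarrow> real \<Rightarrow> real" where
  "lifting w t i k x =
     (if k = 1 then min x (w t i 1) else max (min x (w t i k) - w t i (k - 1)) 0)"

text \<open>
  The columns of the matrix \<open>Y t\<close> are indexed by the triples \<open>(t', i, k)\<close> that label the entries of
  the stacked lifted vector, rather than by their position in the stack.
\<close>

definition lifted_policies ::
    "lin_system \<Rightarrow> (nat \<Rightarrow> nat \<Rightarrow> real) \<Rightarrow> (nat \<Rightarrow> nat \<Rightarrow> real) \<Rightarrow> (nat \<Rightarrow> nat \<Rightarrow> nat)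
      \<Rightarrow> (nat \<Rightarrow> nat \<Rightarrow> nat \<Rightarrow> real) \<Rightarrow> policy set" where
  "lifted_policies S l v p w = {\<pi>.
     \<exists>(Y :: nat \<Rightarrow> nat \<Rightarrow> nat \<times> nat \<times> nat \<Rightarrow> real) (y0 :: nat \<Rightarrow> rvec).
       \<forall>t\<in>{1..horizon S}. \<forall>j\<in>{1..dim_u S}. \<forall>\<xi>\<in>hist_support S l v t.
         \<pi> t \<xi> j =
           (\<Sum>t'=1..t. \<Sum>i=1..dim_xi S. \<Sum>k=1..p t' i.
              Y t j (t', i, k) * lifting w t' i k (\<xi> (t', i))) + y0 t j}"

definition additive_policies ::
    "lin_system \<Rightarrow> (nat \<Rightarrow> nat \<Rightarrow> real) \<Rightarrow> (nat \<Rightarrow> nat \<Rightarrow> real) \<Rightarrow> policy set" where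
  "additive_policies S l v = {\<pi>.
     \<forall>t\<in>{1..horizon S}. \<forall>j\<in>{1..dim_u S}. \<exists>f :: nat \<Rightarrow> nat \<Rightarrow> real \<Rightarrow> real.
       (\<forall>t'\<in>{1..t}. \<forall>i\<in>{1..dim_xi S}. continuous_on {l t' i..v t' i} (f t' i)) \<and>
       (\<forall>\<xi>\<in>hist_support S l v t.
          \<pi> t \<xi> j = (\<Sum>t'=1..t. \<Sum>i=1..dim_xi S. f t' i (\<xi> (t', i))))}"

definition lipschitz_policies ::
    "lin_system \<Rightarrow> (nat \<Rightarrow> nat \<Rightarrow> real) \<Rightarrow> (nat \<Rightarrow> nat \<Rightarrow> real) \<Rightarrow> real \<Rightarrow> policy set" where
  "lipschitz_policies S l v L = {\<pi>.
     \<forall>t\<in>{1..horizon S}. \<forall>j\<in>{1..dim_u S}.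
       \<forall>\<xi>\<in>hist_support S l v t. \<forall>\<xi>'\<in>hist_support S l v t.
         \<bar>\<pi> t \<xi> j - \<pi> t \<xi>' j\<bar> \<le> L * (\<Sum>z\<in>hist_index S t. \<bar>\<xi> z - \<xi>' z\<bar>)}"

text \<open>Extended-real valued, since the supremum norm of an arbitrary policy may be infinite.\<close>

definition policy_dist ::
    "lin_system \<Rightarrow> (nat \<Rightarrow> nat \<Rightarrow> real) \<Rightarrow> (nat \<Rightarrow> nat \<Rightarrow> real) \<Rightarrow> policy \<Rightarrow> policy \<Rightarrow> ereal" where
  "policy_dist S l v \<pi>1 \<pi>2 =
     (\<Sum>t=1..horizon S. \<Sum>j=1..dim_u S.
        SUP \<xi>\<in>hist_support S l v t. ereal \<bar>\<pi>1 t \<xi> j - \<pi>2 t \<xi> j\<bar>)"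

definition policy_ball ::
    "lin_system \<Rightarrow> (nat \<Rightarrow> nat \<Rightarrow> real) \<Rightarrow> (nat \<Rightarrow> nat \<Rightarrow> real) \<Rightarrow> policy \<Rightarrow> real \<Rightarrow> policy set" where
  "policy_ball S l v \<pi>0 \<rho> = {\<pi>. policy_dist S l v \<pi> \<pi>0 \<le> ereal \<rho>}"

definition value_lifted where
  "value_lifted S l v x0 \<alpha> c \<B> \<pi>0 \<rho> p w L =
     optimal_value S x0 \<alpha> c \<B> (policy_ball S l v \<pi>0 \<rho>)
       (lifted_policies S l v p w \<inter> lipschitz_policies S l v L)"

definition value_additive where
  "value_additive S l v x0 \<alpha> c \<B> \<pi>0 \<rho> L =
     optimal_value S x0 \<alpha> c \<B> (policy_ball S l v \<pi>0 \<rho>)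
       (additive_policies S l v \<inter> lipschitz_policies S l v L)"

definition hypotheses ::
    "lin_system \<Rightarrow> (nat \<Rightarrow> nat \<Rightarrow> real) \<Rightarrow> (nat \<Rightarrow> nat \<Rightarrow> real) \<Rightarrow> (nat \<Rightarrow> real) \<Rightarrow> real \<Rightarrow> cost
      \<Rightarrow> disturbance measure set \<Rightarrow> policy \<Rightarrow> real \<Rightarrow> (nat \<Rightarrow> nat \<Rightarrow> nat)
      \<Rightarrow> (nat \<Rightarrow> nat \<Rightarrow> nat \<Rightarrow> real) \<Rightarrow> bool" where
  "hypotheses S l v \<alpha> Lc c \<B> \<pi>0 \<rho> p w \<longleftrightarrow>
     wf_system S \<and> wf_support S l v \<and> (\<forall>t\<in>{1..horizon S}. 0 \<le> \<alpha> t \<and> \<alpha> t \<le> 1) \<and>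
     lipschitz_cost S Lc c \<and> ambiguity_set S l v \<B> \<and> breakpoints S l v p w \<and>
     \<pi>0 \<in> lifted_policies S l v p w \<and> 0 \<le> \<rho>"

end

theory Submission
  imports Defs
begin

text \<open>
  A lifted policy is a sum, over the coordinates of the history, of one-dimensional functions that
  are continuous and affine between consecutive breakpoints.  The upper bound rests on replacing
  every summand of an additive policy by its piecewise linear interpolant at the breakpoints.  This
  keeps the policy feasible for two reasons.
  \<^item> The Lipschitz constant does not grow, since the slopes of the interpolant are difference
  quotients of the summand, which is itself \<open>L\<close>-Lipschitz (vary one coordinate of the history).
  \<^item> The distance to the lifted centre of the ball does not grow.  The difference of two lifted
  components is again a sum of functions that are affine between breakpoints, so its extrema are
  attained where all coordinates are breakpoints; there the interpolated policy agrees with the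
  original one.
  
  Between breakpoints the two policies differ by at most \<open>2 * L * \<epsilon>\<close> per coordinate, and the
  linear dynamics and the Lipschitz costs turn this into a cost difference of order \<open>\<epsilon>\<close>, uniformly in
  the disturbance and hence in the probability measure.  These steps are
  \<open>lifted_policy_approximation\<close>, \<open>total_cost_gap\<close> and \<open>value_lifted_le_value_additive\<close>.  Comparing
  expectations needs integrability: the total cost of a Lipschitz policy is itself Lipschitz on the
  compact support, hence bounded and Borel.
  
  For tightness the dynamics copy the first disturbance into the second state, and the cost charges
  the deviation of the control from \<open>L * \<bar>x\<bar>\<close>.  This target is an admissible additive policy of cost
  \<open>0\<close>.  On a uniform grid with an odd number of segments the kink at \<open>0\<close> lies in the middle of a
  segment, where a lifted policy is affine; against the three Dirac measures at the ends and the
  midpoint of that segment it must pay an amount proportional to the segment length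
  (\<open>tight_instance\<close>).
\<close>

section \<open>Lifted functions of one variable\<close>

definition lifted_sum ::
    "(nat \<Rightarrow> nat \<Rightarrow> nat \<Rightarrow> real) \<Rightarrow> nat \<Rightarrow> nat \<Rightarrow> nat \<Rightarrow> (nat \<Rightarrow> real) \<Rightarrow> real \<Rightarrow> real" where
  "lifted_sum w t i n Y x = (\<Sum>k=1..n. Y k * lifting w t i k x)"

definition nodes_ordered :: "(nat \<Rightarrow> nat \<Rightarrow> nat \<Rightarrow> real) \<Rightarrow> nat \<Rightarrow> nat \<Rightarrow> nat \<Rightarrow> bool" where
  "nodes_ordered w t i n \<longleftrightarrow> (\<forall>k\<in>{1..n}. w t i (k - 1) \<le> w t i k)"

lemma nodes_mono:
  assumes "nodes_ordered w t i n" "a \<le> b" "b \<le> n"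
  shows "w t i a \<le> w t i b"
  using assms(2,3)
proof (induction b rule: dec_induct)
  case (step b)
  then show ?case using assms(1)[unfolded nodes_ordered_def, rule_format, of "Suc b"] by auto
qed simp

lemma segment_cover:
  fixes w :: "nat \<Rightarrow> real"
  assumes "1 \<le> n" "w 0 \<le> x" "x \<le> w n"
  obtains m where "m \<in> {1..n}" "w (m - 1) \<le> x" "x \<le> w m"
proof -
  have "\<exists>m\<in>{1..n}. w (m - 1) \<le> x \<and> x \<le> w m"
    using assms
  proof (induction n)
    case (Suc n)
    show ?case
    proof (cases "1 \<le> n \<and> x \<le> w n")
      case True
      then show ?thesis using Suc by fastforce
    next
      case False
      then have "w n \<le> x" using Suc.prems by (cases n) auto
      then show ?thesis using Suc.prems by (intro bexI[of _ "Suc n"]) auto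
    qed
  qed simp
  then show ?thesis using that by blast
qed

text \<open>
  Inside the \<open>m\<close>-th segment only the \<open>m\<close>-th lifted coordinate moves: the earlier ones are saturated
  and the later ones still vanish.
\<close>

lemma lifting_on_segment:
  assumes mono: "nodes_ordered w t i n"
    and m: "m \<in> {1..n}" and k: "k \<in> {1..n}"
    and x: "w t i (m - 1) \<le> x" "x \<le> w t i m"
  shows "lifting w t i k x
    = lifting w t i k (w t i (m - 1)) + (if k = m then x - w t i (m - 1) else 0)"
proof -
  note nm = nodes_mono[OF mono]
  consider "k < m" | "k = m" | "m < k" by linarith
  then show ?thesis
  proof cases
    case 1
    then have "w t i k \<le> w t i (m - 1)" using m by (intro nm) auto
    then show ?thesis using 1 x by (auto simp: lifting_def)
  next
    case 2
    then show ?thesis using x by (auto simp: lifting_def)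
  next
    case 3
    then have "w t i m \<le> w t i (k - 1)" using k by (intro nm) auto
    then show ?thesis using 3 x m by (simp add: lifting_def)
  qed
qed

lemma lifted_sum_on_segment:
  assumes mono: "nodes_ordered w t i n"
    and m: "m \<in> {1..n}" and x: "w t i (m - 1) \<le> x" "x \<le> w t i m"
  shows "lifted_sum w t i n Y x
    = lifted_sum w t i n Y (w t i (m - 1)) + Y m * (x - w t i (m - 1))"
proof -
  have "lifted_sum w t i n Y x = (\<Sum>k=1..n. Y k * lifting w t i k (w t i (m - 1))
      + (if k = m then Y k * (x - w t i (m - 1)) else 0))"
    unfolding lifted_sum_def
    by (intro sum.cong refl) (simp add: lifting_on_segment[OF mono m _ x] algebra_simps)
  then show ?thesis using m by (simp add: lifted_sum_def sum.distrib sum.delta)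
qed

lemma lifted_sum_node:
  assumes mono: "nodes_ordered w t i n" and "m \<le> n"
  shows "lifted_sum w t i n Y (w t i m)
    = lifted_sum w t i n Y (w t i 0) + (\<Sum>k=1..m. Y k * (w t i k - w t i (k - 1)))"
  using assms(2)
proof (induction m)
  case (Suc m)
  have "w t i m \<le> w t i (Suc m)" using Suc.prems by (intro nodes_mono[OF mono]) auto
  then show ?case
    using lifted_sum_on_segment[OF mono, of "Suc m" "w t i (Suc m)" Y] Suc by simp
qed simp

text \<open>
  The lifting splits the variable into the parts that lie in the successive segments, so the
  increments of its coordinates add up to the increment of the variable.
\<close>

lemma lifted_sum_one:
  assumes mono: "nodes_ordered w t i n" and "1 \<le> n"
    and x: "w t i 0 \<le> x" "x \<le> w t i n"
  shows "lifted_sum w t i n (\<lambda>_. 1) x = lifted_sum w t i n (\<lambda>_. 1) (w t i 0) + (x - w t i 0)"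
proof -
  obtain m where m: "m \<in> {1..n}" "w t i (m - 1) \<le> x" "x \<le> w t i m"
    using segment_cover[of n "w t i" x] assms by blast
  have telescope: "(\<Sum>k=1..r. w t i k - w t i (k - 1)) = w t i r - w t i 0" for r
    by (induction r) auto
  have "m - 1 \<le> n" using m(1) by auto
  then show ?thesis
    using lifted_sum_on_segment[OF mono m, of "\<lambda>_. 1"]
      lifted_sum_node[OF mono, of "m - 1" "\<lambda>_. 1"] telescope
    by simp
qed

lemma lifting_mono: "x \<le> y \<Longrightarrow> lifting w t i k x \<le> lifting w t i k y"
  by (auto simp: lifting_def)

text \<open>
  Every lifted coordinate is nondecreasing, and their increments add up to \<open>\<bar>x - y\<bar>\<close>; a combination
  with coefficients bounded by \<open>L\<close> therefore changes by at most \<open>L * \<bar>x - y\<bar>\<close>.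
\<close>

lemma lifted_sum_lipschitz:
  assumes mono: "nodes_ordered w t i n" and n: "1 \<le> n"
    and Y: "\<And>k. k \<in> {1..n} \<Longrightarrow> \<bar>Y k\<bar> \<le> L"
    and x: "x \<in> {w t i 0..w t i n}" and y: "y \<in> {w t i 0..w t i n}"
  shows "\<bar>lifted_sum w t i n Y x - lifted_sum w t i n Y y\<bar> \<le> L * \<bar>x - y\<bar>"
  using x y
proof (induction x y rule: linorder_wlog)
  case (le x y)
  have "\<bar>lifted_sum w t i n Y x - lifted_sum w t i n Y y\<bar>
      = \<bar>\<Sum>k=1..n. Y k * (lifting w t i k x - lifting w t i k y)\<bar>"
    by (simp add: lifted_sum_def sum_subtractf algebra_simps)
  also have "\<dots> \<le> (\<Sum>k=1..n. \<bar>Y k * (lifting w t i k x - lifting w t i k y)\<bar>)"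
    by (rule sum_abs)
  also have "\<dots> \<le> (\<Sum>k=1..n. L * (lifting w t i k y - lifting w t i k x))"
    using Y lifting_mono[OF le(1)]
    by (intro sum_mono) (auto simp: abs_mult abs_of_nonpos intro!: mult_right_mono)
  also have "\<dots> = L * (lifted_sum w t i n (\<lambda>_. 1) y - lifted_sum w t i n (\<lambda>_. 1) x)"
    by (simp add: lifted_sum_def sum_distrib_left sum_subtractf algebra_simps)
  also have "\<dots> = L * \<bar>x - y\<bar>"
    using lifted_sum_one[OF mono n, of x] lifted_sum_one[OF mono n, of y] le by simp
  finally show ?case .
next
  case (sym x y)
  then show ?case by (simp add: abs_minus_commute)
qed

text \<open>
  An affine function on a segment is largest at one of the two ends, depending on the sign of its slope.
\<close>

lemma lifted_sum_max_at_node: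
  assumes mono: "nodes_ordered w t i n" and n: "1 \<le> n"
    and x: "x \<in> {w t i 0..w t i n}"
  shows "\<exists>m\<le>n. lifted_sum w t i n Y x \<le> lifted_sum w t i n Y (w t i m)"
proof -
  obtain m where m: "m \<in> {1..n}" "w t i (m - 1) \<le> x" "x \<le> w t i m"
    using segment_cover[of n "w t i" x] n x by auto
  have A: "lifted_sum w t i n Y z
    = lifted_sum w t i n Y (w t i (m - 1)) + Y m * (z - w t i (m - 1))"
    if "w t i (m - 1) \<le> z" "z \<le> w t i m" for z
    using that by (rule lifted_sum_on_segment[OF mono m(1)])
  show ?thesis
  proof (cases "0 \<le> Y m")
    case True
    then have "Y m * (x - w t i (m - 1)) \<le> Y m * (w t i m - w t i (m - 1))"
      using m by (intro mult_left_mono) auto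
    then have "lifted_sum w t i n Y x \<le> lifted_sum w t i n Y (w t i m)"
      using A[OF m(2,3)] A[of "w t i m"] m(2,3) by linarith
    then show ?thesis using m by auto
  next
    case False
    then have "Y m * (x - w t i (m - 1)) \<le> 0" using m by (intro mult_nonpos_nonneg) auto
    then have "lifted_sum w t i n Y x \<le> lifted_sum w t i n Y (w t i (m - 1))"
      using A[OF m(2,3)] by linarith
    then show ?thesis using m by (intro exI[of _ "m - 1"]) auto
  qed
qed

text \<open>
  On a degenerate segment the quotient is \<open>0\<close> by the convention for division, which is consistent: the
  lifted coordinate of such a segment is constant.
\<close>

definition slope ::
    "(nat \<Rightarrow> nat \<Rightarrow> nat \<Rightarrow> real) \<Rightarrow> nat \<Rightarrow> nat \<Rightarrow> (real \<Rightarrow> real) \<Rightarrow> nat \<Rightarrow> real" where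
  "slope w t i f k = (f (w t i k) - f (w t i (k - 1))) / (w t i k - w t i (k - 1))"

definition interpolant ::
    "(nat \<Rightarrow> nat \<Rightarrow> nat \<Rightarrow> real) \<Rightarrow> nat \<Rightarrow> nat \<Rightarrow> nat \<Rightarrow> (real \<Rightarrow> real) \<Rightarrow> real \<Rightarrow> real" where
  "interpolant w t i n f x = lifted_sum w t i n (slope w t i f) x
     + (f (w t i 0) - lifted_sum w t i n (slope w t i f) (w t i 0))"

lemma interpolant_at_node:
  assumes mono: "nodes_ordered w t i n" and "m \<le> n"
  shows "interpolant w t i n f (w t i m) = f (w t i m)"
proof -
  have "slope w t i f k * (w t i k - w t i (k - 1)) = f (w t i k) - f (w t i (k - 1))" for k
    by (cases "w t i k = w t i (k - 1)") (auto simp: slope_def)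
  moreover have "(\<Sum>k=1..m. f (w t i k) - f (w t i (k - 1))) = f (w t i m) - f (w t i 0)"
    by (induction m) auto
  ultimately show ?thesis
    by (simp add: interpolant_def lifted_sum_node[OF assms])
qed

lemma interpolant_lipschitz:
  assumes mono: "nodes_ordered w t i n" and n: "1 \<le> n"
    and f: "L-lipschitz_on {w t i 0..w t i n} f"
  shows "L-lipschitz_on {w t i 0..w t i n} (interpolant w t i n f)"
proof (rule lipschitz_onI)
  show L: "0 \<le> L" using f by (rule lipschitz_on_nonneg)
  have S: "\<bar>slope w t i f k\<bar> \<le> L" if "k \<in> {1..n}" for k
  proof (cases "w t i k = w t i (k - 1)")
    case False
    have "w t i (k - 1) < w t i k" using False nodes_mono[OF mono, of "k - 1" k] that by simp
    moreover have "w t i k \<in> {w t i 0..w t i n}" "w t i (k - 1) \<in> {w t i 0..w t i n}"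
      using that by (auto intro!: nodes_mono[OF mono])
    ultimately show ?thesis
      using lipschitz_onD[OF f, of "w t i k" "w t i (k - 1)"]
      by (simp add: slope_def dist_real_def field_simps)
  qed (use L in \<open>auto simp: slope_def\<close>)
  fix x y assume "x \<in> {w t i 0..w t i n}" "y \<in> {w t i 0..w t i n}"
  with lifted_sum_lipschitz[where Y = "slope w t i f", OF mono n S]
  show "dist (interpolant w t i n f x) (interpolant w t i n f y) \<le> L * dist x y"
    by (simp add: interpolant_def dist_real_def)
qed

lemma interpolant_error:
  assumes mono: "nodes_ordered w t i n" and n: "1 \<le> n"
    and f: "L-lipschitz_on {w t i 0..w t i n} f"
    and \<epsilon>: "\<And>k. k \<in> {1..n} \<Longrightarrow> w t i k - w t i (k - 1) \<le> \<epsilon>"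
    and x: "x \<in> {w t i 0..w t i n}"
  shows "\<bar>f x - interpolant w t i n f x\<bar> \<le> 2 * L * \<epsilon>"
proof -
  have L: "0 \<le> L" using f by (rule lipschitz_on_nonneg)
  obtain m where m: "m \<in> {1..n}" "w t i (m - 1) \<le> x" "x \<le> w t i m"
    using segment_cover[of n "w t i" x] n x by auto
  let ?a = "w t i (m - 1)"
  have a: "?a \<in> {w t i 0..w t i n}" using m by (auto intro!: nodes_mono[OF mono])
  have "\<bar>x - ?a\<bar> \<le> \<epsilon>" using \<epsilon>[OF m(1)] m by auto
  then have "L * \<bar>x - ?a\<bar> \<le> L * \<epsilon>" using L by (rule mult_left_mono)
  moreover have "\<bar>f x - f ?a\<bar> \<le> L * \<bar>x - ?a\<bar>"
    using lipschitz_onD[OF f x a] by (simp add: dist_real_def)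
  moreover have "m - 1 \<le> n" using m(1) by auto
  then have "\<bar>interpolant w t i n f x - f ?a\<bar> \<le> L * \<bar>x - ?a\<bar>"
    using lipschitz_onD[OF interpolant_lipschitz[OF mono n f] x a]
      interpolant_at_node[OF mono, of "m - 1" f] by (simp add: dist_real_def)
  ultimately show ?thesis by linarith
qed

section \<open>Interpolation of an additive component\<close>

definition lifted_component ::
    "lin_system \<Rightarrow> (nat \<Rightarrow> nat \<Rightarrow> nat) \<Rightarrow> (nat \<Rightarrow> nat \<Rightarrow> nat \<Rightarrow> real) \<Rightarrow> nat
      \<Rightarrow> (nat \<times> nat \<times> nat \<Rightarrow> real) \<Rightarrow> real \<Rightarrow> disturbance \<Rightarrow> real" where
  "lifted_component S p w t Y y \<xi> =
     (\<Sum>t'=1..t. \<Sum>i=1..dim_xi S. \<Sum>k=1..p t' i.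
        Y (t', i, k) * lifting w t' i k (\<xi> (t', i))) + y"

lemma sum_hist_index:
  "(\<Sum>t'=1..t. \<Sum>i=1..dim_xi S. g t' i) = (\<Sum>z\<in>hist_index S t. g (fst z) (snd z))"
  by (simp add: hist_index_def sum.cartesian_product case_prod_beta)

lemma lifted_component_hist_index:
  "lifted_component S p w t Y y \<xi> = (\<Sum>z\<in>hist_index S t.
     lifted_sum w (fst z) (snd z) (p (fst z) (snd z)) (\<lambda>k. Y (fst z, snd z, k)) (\<xi> z)) + y"
  unfolding lifted_component_def lifted_sum_def sum_hist_index by simp

lemma finite_hist_index [simp]: "finite (hist_index S t)"
  by (simp add: hist_index_def)

lemma card_hist_index [simp]: "card (hist_index S t) = t * dim_xi S"
  by (simp add: hist_index_def)

lemma hist_support_iff: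
  "\<xi> \<in> hist_support S l v t \<longleftrightarrow> \<xi> \<in> extensional (hist_index S t) \<and>
     (\<forall>z\<in>hist_index S t. \<xi> z \<in> {l (fst z) (snd z)..v (fst z) (snd z)})"
  by (auto simp: hist_support_def PiE_iff)

lemma hist_support_fun_upd:
  assumes "\<xi> \<in> hist_support S l v t" "z \<in> hist_index S t" "x \<in> {l (fst z) (snd z)..v (fst z) (snd z)}"
  shows "\<xi>(z := x) \<in> hist_support S l v t"
  using assms by (auto simp: hist_support_iff extensional_def)

lemma hist_support_nonempty:
  assumes "breakpoints S l v p w" "t \<le> horizon S"
  shows "hist_support S l v t \<noteq> {}"
proof -
  have "l t' i \<le> v t' i" if "t' \<in> {1..t}" "i \<in> {1..dim_xi S}" for t' i
    using assms that nodes_mono[of w t' i "p t' i" 0 "p t' i"]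
    by (auto simp: breakpoints_def nodes_ordered_def)
  then have "restrict (\<lambda>z. l (fst z) (snd z)) (hist_index S t) \<in> hist_support S l v t"
    by (auto simp: hist_support_iff hist_index_def)
  then show ?thesis by blast
qed

text \<open>
  Two histories that differ in a single coordinate isolate the corresponding summand.
\<close>

lemma additive_summand_lipschitz:
  fixes f :: "nat \<times> nat \<Rightarrow> real \<Rightarrow> real"
  assumes ne: "hist_support S l v t \<noteq> {}" and "0 \<le> L"
    and lip: "\<forall>\<xi>\<in>hist_support S l v t. \<forall>\<xi>'\<in>hist_support S l v t.
        \<bar>a \<xi> - a \<xi>'\<bar> \<le> L * (\<Sum>z\<in>hist_index S t. \<bar>\<xi> z - \<xi>' z\<bar>)"
    and a: "\<And>\<xi>. \<xi> \<in> hist_support S l v t \<Longrightarrow> a \<xi> = (\<Sum>z\<in>hist_index S t. f z (\<xi> z))"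
    and z: "z \<in> hist_index S t"
  shows "L-lipschitz_on {l (fst z) (snd z)..v (fst z) (snd z)} (f z)"
proof (rule lipschitz_onI)
  fix x y assume xy: "x \<in> {l (fst z) (snd z)..v (fst z) (snd z)}"
    "y \<in> {l (fst z) (snd z)..v (fst z) (snd z)}"
  obtain \<xi> where \<xi>: "\<xi> \<in> hist_support S l v t" using ne by blast
  note U = hist_support_fun_upd[OF \<xi> z xy(1)] hist_support_fun_upd[OF \<xi> z xy(2)]
  have "a (\<xi>(z := x)) - a (\<xi>(z := y)) = (\<Sum>q\<in>hist_index S t. if q = z then f z x - f z y else 0)"
    unfolding a[OF U(1)] a[OF U(2)] sum_subtractf[symmetric] by (intro sum.cong) auto
  also have "\<dots> = f z x - f z y" using z by simp
  finally have A: "a (\<xi>(z := x)) - a (\<xi>(z := y)) = f z x - f z y" .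
  have "(\<Sum>q\<in>hist_index S t. \<bar>(\<xi>(z := x)) q - (\<xi>(z := y)) q\<bar>)
      = (\<Sum>q\<in>hist_index S t. if q = z then \<bar>x - y\<bar> else 0)"
    by (intro sum.cong) auto
  then have "(\<Sum>q\<in>hist_index S t. \<bar>(\<xi>(z := x)) q - (\<xi>(z := y)) q\<bar>) = \<bar>x - y\<bar>" using z by simp
  then show "dist (f z x) (f z y) \<le> L * dist x y"
    using lip U A by (metis dist_real_def)
qed fact

lemma breakpointsD:
  assumes "breakpoints S l v p w" "t \<le> horizon S" "z \<in> hist_index S t"
  shows "nodes_ordered w (fst z) (snd z) (p (fst z) (snd z))"
    and "1 \<le> p (fst z) (snd z)"
    and "w (fst z) (snd z) 0 = l (fst z) (snd z)"
    and "w (fst z) (snd z) (p (fst z) (snd z)) = v (fst z) (snd z)"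
  using assms by (auto simp: breakpoints_def hist_index_def nodes_ordered_def)

definition at_nodes where
  "at_nodes S p w t \<eta> \<longleftrightarrow>
     (\<forall>z\<in>hist_index S t. \<exists>m\<le>p (fst z) (snd z). \<eta> z = w (fst z) (snd z) m)"

text \<open>
  The coordinates of a history vary independently over the box, so the one-dimensional maximum
  principle can be applied to each summand separately.
\<close>

lemma lifted_component_max_at_nodes:
  assumes bp: "breakpoints S l v p w" and t: "t \<le> horizon S"
    and \<xi>: "\<xi> \<in> hist_support S l v t"
  obtains \<eta> where "\<eta> \<in> hist_support S l v t" "at_nodes S p w t \<eta>"
    "lifted_component S p w t Y y \<xi> \<le> lifted_component S p w t Y y \<eta>"
proof -
  let ?g = "\<lambda>z. lifted_sum w (fst z) (snd z) (p (fst z) (snd z)) (\<lambda>k. Y (fst z, snd z, k))"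
  note B = breakpointsD[OF bp t]
  have "\<forall>z\<in>hist_index S t. \<exists>m\<le>p (fst z) (snd z). ?g z (\<xi> z) \<le> ?g z (w (fst z) (snd z) m)"
    using \<xi> B by (intro ballI lifted_sum_max_at_node) (auto simp: hist_support_iff)
  then obtain m where m: "\<And>z. z \<in> hist_index S t \<Longrightarrow> m z \<le> p (fst z) (snd z)"
    "\<And>z. z \<in> hist_index S t \<Longrightarrow> ?g z (\<xi> z) \<le> ?g z (w (fst z) (snd z) (m z))"
    by metis
  define \<eta> where "\<eta> = restrict (\<lambda>z. w (fst z) (snd z) (m z)) (hist_index S t)"
  have "w (fst z) (snd z) (m z) \<in> {l (fst z) (snd z)..v (fst z) (snd z)}"
    if "z \<in> hist_index S t" for z
    using nodes_mono[OF B(1)[OF that], of 0 "m z"]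
      nodes_mono[OF B(1)[OF that], of "m z" "p (fst z) (snd z)"] B(3,4)[OF that] m(1)[OF that]
    by auto
  then have "\<eta> \<in> hist_support S l v t" by (auto simp: hist_support_iff \<eta>_def)
  moreover have "at_nodes S p w t \<eta>" using m(1) by (auto simp: at_nodes_def \<eta>_def)
  moreover have "lifted_component S p w t Y y \<xi> \<le> lifted_component S p w t Y y \<eta>"
    unfolding lifted_component_hist_index using m(2)
    by (intro add_right_mono sum_mono) (auto simp: \<eta>_def)
  ultimately show ?thesis by (rule that)
qed

lemma lifted_component_diff:
  "lifted_component S p w t Y y \<xi> - lifted_component S p w t Y' y' \<xi>
    = lifted_component S p w t (\<lambda>q. Y q - Y' q) (y - y') \<xi>"
  unfolding lifted_component_def left_diff_distrib sum_subtractf by (rule add_diff_add)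

lemma finite_segments:
  fixes w :: "nat \<Rightarrow> nat \<Rightarrow> nat \<Rightarrow> real"
  shows "finite {w t i k - w t i (k - 1) | t i k.
     t \<in> {1..horizon S} \<and> i \<in> {1..dim_xi S} \<and> k \<in> {1..p t i}}"
    (is "finite ?A")
proof (rule finite_subset)
  show "?A \<subseteq> (\<Union>t\<in>{1..horizon S}. \<Union>i\<in>{1..dim_xi S}.
      (\<lambda>k. w t i k - w t i (k - 1)) ` {1..p t i})"
    by (rule subsetI, elim CollectE exE conjE) (rule UN_I, assumption, rule UN_I, assumption,
      rule image_eqI, assumption+)
qed auto

lemma largest_segment_upper:
  assumes "t \<in> {1..horizon S}" "i \<in> {1..dim_xi S}" "k \<in> {1..p t i}"
  shows "w t i k - w t i (k - 1) \<le> largest_segment S p w"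
  unfolding largest_segment_def
proof (rule Max_ge[OF finite_segments])
  show "w t i k - w t i (k - 1) \<in> {w t i k - w t i (k - 1) | t i k.
     t \<in> {1..horizon S} \<and> i \<in> {1..dim_xi S} \<and> k \<in> {1..p t i}}"
    by (rule CollectI, rule exI[of _ t], rule exI[of _ i], rule exI[of _ k])
      (simp add: assms[simplified])
qed

text \<open>
  The interpolant of one additive component.  The last conjunct is the form in which the maximum
  principle is used: against any lifted component, the interpolant deviates nowhere more than the
  original does at some history, namely one made of breakpoints.
\<close>

lemma lifted_component_approximation:
  fixes f :: "nat \<times> nat \<Rightarrow> real \<Rightarrow> real"
  assumes bp: "breakpoints S l v p w" and t: "t \<le> horizon S" and L: "0 \<le> L"
    and lip: "\<forall>\<xi>\<in>hist_support S l v t. \<forall>\<xi>'\<in>hist_support S l v t.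
        \<bar>a \<xi> - a \<xi>'\<bar> \<le> L * (\<Sum>z\<in>hist_index S t. \<bar>\<xi> z - \<xi>' z\<bar>)"
    and a: "\<And>\<xi>. \<xi> \<in> hist_support S l v t \<Longrightarrow> a \<xi> = (\<Sum>z\<in>hist_index S t. f z (\<xi> z))"
  shows "\<exists>Y y.
    (\<forall>\<xi>\<in>hist_support S l v t. \<forall>\<xi>'\<in>hist_support S l v t.
        \<bar>lifted_component S p w t Y y \<xi> - lifted_component S p w t Y y \<xi>'\<bar>
          \<le> L * (\<Sum>z\<in>hist_index S t. \<bar>\<xi> z - \<xi>' z\<bar>)) \<and>
    (\<forall>\<xi>\<in>hist_support S l v t. \<bar>a \<xi> - lifted_component S p w t Y y \<xi>\<bar>
        \<le> real (t * dim_xi S) * (2 * L * largest_segment S p w)) \<and>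
    (\<forall>Y0 y0. \<forall>\<xi>\<in>hist_support S l v t. \<exists>\<eta>\<in>hist_support S l v t.
        \<bar>lifted_component S p w t Y y \<xi> - lifted_component S p w t Y0 y0 \<xi>\<bar>
          \<le> \<bar>a \<eta> - lifted_component S p w t Y0 y0 \<eta>\<bar>)"
proof -
  let ?HS = "hist_support S l v t" and ?I = "hist_index S t"
  note B = breakpointsD[OF bp t]
  have flip: "L-lipschitz_on {w (fst z) (snd z) 0..w (fst z) (snd z) (p (fst z) (snd z))} (f z)"
    if "z \<in> ?I" for z
    using additive_summand_lipschitz[OF hist_support_nonempty[OF bp t] L lip a that] B(3,4)[OF that]
    by simp
  define g where "g z = interpolant w (fst z) (snd z) (p (fst z) (snd z)) (f z)" for z
  define Y where "Y = (\<lambda>(t', i, k). slope w t' i (f (t', i)) k)"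
  define y where "y = (\<Sum>z\<in>?I. f z (w (fst z) (snd z) 0)
    - lifted_sum w (fst z) (snd z) (p (fst z) (snd z)) (slope w (fst z) (snd z) (f z))
        (w (fst z) (snd z) 0))"
  have Yz: "(\<lambda>k. Y (fst z, snd z, k)) = slope w (fst z) (snd z) (f z)" for z
    by (simp add: Y_def)
  have a': "lifted_component S p w t Y y \<xi> = (\<Sum>z\<in>?I. g z (\<xi> z))" for \<xi>
    unfolding lifted_component_hist_index Yz y_def g_def interpolant_def
    by (simp add: sum.distrib)
  have range: "\<xi> z \<in> {w (fst z) (snd z) 0..w (fst z) (snd z) (p (fst z) (snd z))}"
    if "\<xi> \<in> ?HS" "z \<in> ?I" for \<xi> z
    using that B(3,4)[OF that(2)] by (auto simp: hist_support_iff)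
  show ?thesis
  proof (intro exI[of _ Y] exI[of _ y] conjI ballI allI)
    fix \<xi> \<xi>' assume \<xi>: "\<xi> \<in> ?HS" "\<xi>' \<in> ?HS"
    have "\<bar>g z (\<xi> z) - g z (\<xi>' z)\<bar> \<le> L * \<bar>\<xi> z - \<xi>' z\<bar>" if z: "z \<in> ?I" for z
      using lipschitz_onD[OF interpolant_lipschitz[OF B(1,2)[OF z] flip[OF z]]
          range[OF \<xi>(1) z] range[OF \<xi>(2) z]]
      by (simp add: g_def dist_real_def)
    then show "\<bar>lifted_component S p w t Y y \<xi> - lifted_component S p w t Y y \<xi>'\<bar>
          \<le> L * (\<Sum>z\<in>?I. \<bar>\<xi> z - \<xi>' z\<bar>)"
      unfolding a' sum_subtractf[symmetric] sum_distrib_left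
      by (intro order_trans[OF sum_abs] sum_mono)
  next
    fix \<xi> assume \<xi>: "\<xi> \<in> ?HS"
    have "\<bar>f z (\<xi> z) - g z (\<xi> z)\<bar> \<le> 2 * L * largest_segment S p w" if z: "z \<in> ?I" for z
      unfolding g_def using z t
      by (intro interpolant_error[OF B(1,2)[OF z] flip[OF z] _ range[OF \<xi> z]] largest_segment_upper)
        (auto simp: hist_index_def)
    then have "(\<Sum>z\<in>?I. \<bar>f z (\<xi> z) - g z (\<xi> z)\<bar>) \<le> (\<Sum>z\<in>?I. 2 * L * largest_segment S p w)"
      by (rule sum_mono)
    then show "\<bar>a \<xi> - lifted_component S p w t Y y \<xi>\<bar>
        \<le> real (t * dim_xi S) * (2 * L * largest_segment S p w)"
      unfolding a' a[OF \<xi>] sum_subtractf[symmetric]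
      by (intro order_trans[OF sum_abs]) simp
  next
    fix Y0 y0 \<xi> assume \<xi>: "\<xi> \<in> ?HS"
    let ?b = "lifted_component S p w t Y0 y0" and ?a = "lifted_component S p w t Y y"
    have node: "?a \<eta> = a \<eta>" if "at_nodes S p w t \<eta>" "\<eta> \<in> ?HS" for \<eta>
      unfolding a' a[OF that(2)]
    proof (intro sum.cong refl)
      fix z assume z: "z \<in> ?I"
      have "\<exists>m\<le>p (fst z) (snd z). \<eta> z = w (fst z) (snd z) m"
        using that(1) z by (simp add: at_nodes_def)
      then obtain m where m: "m \<le> p (fst z) (snd z)" "\<eta> z = w (fst z) (snd z) m"
        by (elim exE conjE)
      show "g z (\<eta> z) = f z (\<eta> z)"
        unfolding g_def m(2) by (rule interpolant_at_node[OF B(1)[OF z] m(1)])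
    qed
    \<comment> \<open>One maximiser for each sign of the deviation.\<close>
    obtain \<eta>1 where 1: "\<eta>1 \<in> ?HS" "at_nodes S p w t \<eta>1" "?a \<xi> - ?b \<xi> \<le> ?a \<eta>1 - ?b \<eta>1"
      unfolding lifted_component_diff by (rule lifted_component_max_at_nodes[OF bp t \<xi>])
    obtain \<eta>2 where 2: "\<eta>2 \<in> ?HS" "at_nodes S p w t \<eta>2" "?b \<xi> - ?a \<xi> \<le> ?b \<eta>2 - ?a \<eta>2"
      unfolding lifted_component_diff by (rule lifted_component_max_at_nodes[OF bp t \<xi>])
    show "\<exists>\<eta>\<in>?HS. \<bar>?a \<xi> - ?b \<xi>\<bar> \<le> \<bar>a \<eta> - ?b \<eta>\<bar>"
    proof (cases "?b \<xi> \<le> ?a \<xi>")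
      case True
      then show ?thesis using 1(3) node[OF 1(2,1)] by (intro bexI[OF _ 1(1)]) linarith
    next
      case False
      then show ?thesis using 2(3) node[OF 2(2,1)] by (intro bexI[OF _ 2(1)]) linarith
    qed
  qed
qed

lemma lifted_policies_iff:
  "\<pi> \<in> lifted_policies S l v p w \<longleftrightarrow>
     (\<exists>Y y0. \<forall>t\<in>{1..horizon S}. \<forall>j\<in>{1..dim_u S}. \<forall>\<xi>\<in>hist_support S l v t.
        \<pi> t \<xi> j = lifted_component S p w t (Y t j) (y0 t j) \<xi>)"
  unfolding lifted_policies_def lifted_component_def mem_Collect_eq ..

lemma lifted_policy_approximation:
  assumes bp: "breakpoints S l v p w" and L: "0 \<le> L"
    and \<pi>: "\<pi> \<in> additive_policies S l v" "\<pi> \<in> lipschitz_policies S l v L"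
      "\<pi> \<in> policy_ball S l v \<pi>0 \<rho>"
    and \<pi>0: "\<pi>0 \<in> lifted_policies S l v p w"
  obtains \<pi>' where "\<pi>' \<in> lifted_policies S l v p w" "\<pi>' \<in> lipschitz_policies S l v L"
    "\<pi>' \<in> policy_ball S l v \<pi>0 \<rho>"
    "\<forall>t\<in>{1..horizon S}. \<forall>j\<in>{1..dim_u S}. \<forall>\<xi>\<in>hist_support S l v t.
       \<bar>\<pi> t \<xi> j - \<pi>' t \<xi> j\<bar> \<le> real (t * dim_xi S) * (2 * L * largest_segment S p w)"
proof -
  obtain Y0 y0 where b: "\<And>t j \<xi>. t \<in> {1..horizon S} \<Longrightarrow> j \<in> {1..dim_u S} \<Longrightarrow>
      \<xi> \<in> hist_support S l v t \<Longrightarrow>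
      \<pi>0 t \<xi> j = lifted_component S p w t (Y0 t j) (y0 t j) \<xi>"
    using \<pi>0 unfolding lifted_policies_iff by (elim exE) (rule that, simp)
  define good where "good t j Y y \<longleftrightarrow>
    (\<forall>\<xi>\<in>hist_support S l v t. \<forall>\<xi>'\<in>hist_support S l v t.
        \<bar>lifted_component S p w t Y y \<xi> - lifted_component S p w t Y y \<xi>'\<bar>
          \<le> L * (\<Sum>z\<in>hist_index S t. \<bar>\<xi> z - \<xi>' z\<bar>)) \<and>
    (\<forall>\<xi>\<in>hist_support S l v t. \<bar>\<pi> t \<xi> j - lifted_component S p w t Y y \<xi>\<bar>
        \<le> real (t * dim_xi S) * (2 * L * largest_segment S p w)) \<and>
    (\<forall>\<xi>\<in>hist_support S l v t. \<exists>\<eta>\<in>hist_support S l v t.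
        \<bar>lifted_component S p w t Y y \<xi> - \<pi>0 t \<xi> j\<bar> \<le> \<bar>\<pi> t \<eta> j - \<pi>0 t \<eta> j\<bar>)" for t j Y y
  have "\<exists>Y y. good t j Y y" if t: "t \<in> {1..horizon S}" and j: "j \<in> {1..dim_u S}" for t j
  proof -
    obtain f where "\<And>\<xi>. \<xi> \<in> hist_support S l v t \<Longrightarrow>
        \<pi> t \<xi> j = (\<Sum>t'=1..t. \<Sum>i=1..dim_xi S. f t' i (\<xi> (t', i)))"
      using \<pi>(1)[unfolded additive_policies_def mem_Collect_eq, rule_format, OF t j]
      by (elim exE conjE) (rule that, simp)
    then have f: "\<And>\<xi>. \<xi> \<in> hist_support S l v t \<Longrightarrow>
        \<pi> t \<xi> j = (\<Sum>z\<in>hist_index S t. (\<lambda>z. f (fst z) (snd z)) z (\<xi> z))"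
      unfolding sum_hist_index by simp
    have lip: "\<forall>\<xi>\<in>hist_support S l v t. \<forall>\<xi>'\<in>hist_support S l v t.
        \<bar>\<pi> t \<xi> j - \<pi> t \<xi>' j\<bar> \<le> L * (\<Sum>z\<in>hist_index S t. \<bar>\<xi> z - \<xi>' z\<bar>)"
      using \<pi>(2) t j by (simp add: lipschitz_policies_def)
    have "t \<le> horizon S" using t by simp
    note * = lifted_component_approximation[where a = "\<lambda>\<xi>. \<pi> t \<xi> j", OF bp this L lip f]
    obtain Y y where Y:
      "\<forall>\<xi>\<in>hist_support S l v t. \<forall>\<xi>'\<in>hist_support S l v t.
        \<bar>lifted_component S p w t Y y \<xi> - lifted_component S p w t Y y \<xi>'\<bar>
          \<le> L * (\<Sum>z\<in>hist_index S t. \<bar>\<xi> z - \<xi>' z\<bar>)"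
      "\<forall>\<xi>\<in>hist_support S l v t. \<bar>\<pi> t \<xi> j - lifted_component S p w t Y y \<xi>\<bar>
        \<le> real (t * dim_xi S) * (2 * L * largest_segment S p w)"
      "\<forall>Y0 y0. \<forall>\<xi>\<in>hist_support S l v t. \<exists>\<eta>\<in>hist_support S l v t.
        \<bar>lifted_component S p w t Y y \<xi> - lifted_component S p w t Y0 y0 \<xi>\<bar>
          \<le> \<bar>\<pi> t \<eta> j - lifted_component S p w t Y0 y0 \<eta>\<bar>"
      by (rule exE[OF *], assumption, elim exE conjE) (rule that)
    have "\<exists>\<eta>\<in>hist_support S l v t.
        \<bar>lifted_component S p w t Y y \<xi> - \<pi>0 t \<xi> j\<bar> \<le> \<bar>\<pi> t \<eta> j - \<pi>0 t \<eta> j\<bar>"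
      if \<xi>: "\<xi> \<in> hist_support S l v t" for \<xi>
      using Y(3)[rule_format, OF \<xi>, of "Y0 t j" "y0 t j"] b[OF t j] \<xi> by auto
    with Y(1,2) have "good t j Y y" unfolding good_def by (intro conjI ballI) simp_all
    then show ?thesis by blast
  qed
  then obtain Y y where Y: "\<And>t j. t \<in> {1..horizon S} \<Longrightarrow> j \<in> {1..dim_u S} \<Longrightarrow> good t j (Y t j) (y t j)"
    by metis
  note Y_lip = Y[unfolded good_def, THEN conjunct1, rule_format]
    and Y_err = Y[unfolded good_def, THEN conjunct2, THEN conjunct1, rule_format]
    and Y_ball = Y[unfolded good_def, THEN conjunct2, THEN conjunct2, rule_format]
  define \<pi>' :: policy where "\<pi>' t \<xi> j = lifted_component S p w t (Y t j) (y t j) \<xi>" for t \<xi> j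
  have "\<pi>' \<in> lifted_policies S l v p w"
    unfolding lifted_policies_iff by (rule exI[of _ Y], rule exI[of _ y]) (simp add: \<pi>'_def)
  moreover have "\<pi>' \<in> lipschitz_policies S l v L"
    unfolding lipschitz_policies_def mem_Collect_eq
  proof (intro ballI)
    fix t j \<xi> \<xi>' assume *: "t \<in> {1..horizon S}" "j \<in> {1..dim_u S}"
      "\<xi> \<in> hist_support S l v t" "\<xi>' \<in> hist_support S l v t"
    show "\<bar>\<pi>' t \<xi> j - \<pi>' t \<xi>' j\<bar> \<le> L * (\<Sum>z\<in>hist_index S t. \<bar>\<xi> z - \<xi>' z\<bar>)"
      unfolding \<pi>'_def by (rule Y_lip[OF *])
  qed
  moreover have "policy_dist S l v \<pi>' \<pi>0 \<le> policy_dist S l v \<pi> \<pi>0"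
    unfolding policy_dist_def
  proof (intro sum_mono SUP_mono)
    fix t j \<xi> assume *: "t \<in> {1..horizon S}" "j \<in> {1..dim_u S}" "\<xi> \<in> hist_support S l v t"
    show "\<exists>\<eta>\<in>hist_support S l v t. ereal \<bar>\<pi>' t \<xi> j - \<pi>0 t \<xi> j\<bar> \<le> ereal \<bar>\<pi> t \<eta> j - \<pi>0 t \<eta> j\<bar>"
      unfolding \<pi>'_def ereal_less_eq(3) by (rule Y_ball[OF *])
  qed
  then have "\<pi>' \<in> policy_ball S l v \<pi>0 \<rho>"
    using \<pi>(3) by (auto simp: policy_ball_def intro: order_trans)
  moreover have "\<forall>t\<in>{1..horizon S}. \<forall>j\<in>{1..dim_u S}. \<forall>\<xi>\<in>hist_support S l v t.
       \<bar>\<pi> t \<xi> j - \<pi>' t \<xi> j\<bar> \<le> real (t * dim_xi S) * (2 * L * largest_segment S p w)"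
    unfolding \<pi>'_def by (intro ballI Y_err)
  ultimately show ?thesis by (rule that)
qed

section \<open>Sensitivity of the total cost\<close>

definition total_cost ::
    "lin_system \<Rightarrow> rvec \<Rightarrow> (nat \<Rightarrow> real) \<Rightarrow> cost \<Rightarrow> policy \<Rightarrow> disturbance \<Rightarrow> real" where
  "total_cost S x0 \<alpha> c \<pi> \<xi> =
     (\<Sum>t=1..horizon S. \<alpha> t * c t (state S x0 \<pi> \<xi> t) (control S \<pi> \<xi> t))"

text \<open>
  A common bound for a change of policy and for a change of disturbance, so that a single sensitivity
  estimate gives both the approximation error and the regularity of the cost in the disturbance.
\<close>

definition input_gap ::
    "lin_system \<Rightarrow> policy \<Rightarrow> disturbance \<Rightarrow> policy \<Rightarrow> disturbance \<Rightarrow> real" where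
  "input_gap S \<pi> \<xi> \<pi>' \<xi>' = (\<Sum>t=1..horizon S.
       norm1 (dim_u S) (\<lambda>j. control S \<pi> \<xi> t j - control S \<pi>' \<xi>' t j)
     + norm1 (dim_xi S) (\<lambda>i. noise \<xi> t i - noise \<xi>' t i))"

lemma norm1_nonneg: "0 \<le> norm1 n x"
  by (simp add: norm1_def sum_nonneg)

lemma norm1_add: "norm1 n (\<lambda>i. x i + y i) \<le> norm1 n x + norm1 n y"
  unfolding norm1_def sum.distrib[symmetric] by (intro sum_mono abs_triangle_ineq)

lemma norm1_matrix:
  "norm1 n (\<lambda>i. \<Sum>k=1..m. A i k * x k) \<le> (\<Sum>i=1..n. \<Sum>k=1..m. \<bar>A i k\<bar>) * norm1 m x"
proof -
  have "\<bar>\<Sum>k=1..m. A i k * x k\<bar> \<le> (\<Sum>k=1..m. \<bar>A i k\<bar>) * norm1 m x" for i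
  proof -
    have "\<bar>x k\<bar> \<le> norm1 m x" if "k \<in> {1..m}" for k
      unfolding norm1_def by (rule member_le_sum[OF that]) auto
    then have "\<bar>A i k * x k\<bar> \<le> \<bar>A i k\<bar> * norm1 m x" if "k \<in> {1..m}" for k
      using that by (simp add: abs_mult mult_left_mono)
    then show ?thesis
      unfolding sum_distrib_right by (intro order_trans[OF sum_abs] sum_mono)
  qed
  then show ?thesis
    unfolding norm1_def[of n] sum_distrib_right[of _ "{1..n}"] by (intro sum_mono)
qed

lemma input_gap_nonneg: "0 \<le> input_gap S \<pi> \<xi> \<pi>' \<xi>'"
  by (simp add: input_gap_def sum_nonneg norm1_nonneg)

lemma input_gap_upper:
  assumes "t \<le> horizon S"
  shows "norm1 (dim_u S) (\<lambda>j. control S \<pi> \<xi> t j - control S \<pi>' \<xi>' t j)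
     + norm1 (dim_xi S) (\<lambda>i. noise \<xi> t i - noise \<xi>' t i) \<le> input_gap S \<pi> \<xi> \<pi>' \<xi>'"
proof (cases "t = 0")
  case True
  then show ?thesis
    using input_gap_nonneg[of S \<pi> \<xi> \<pi>' \<xi>'] by (simp add: control_def noise_def norm1_def)
next
  case False
  then have "t \<in> {1..horizon S}" using assms by simp
  then show ?thesis unfolding input_gap_def
    by (rule member_le_sum) (simp_all add: norm1_nonneg)
qed

text \<open>
  The constant depends on the stage and the matrices only, not on the initial state, the policies
  or the disturbances; each step of the linear recursion enlarges it by the entrywise norms of the
  three matrices.
\<close>

lemma state_gap:
  assumes "t \<le> horizon S"
  shows "\<exists>K\<ge>0. \<forall>x0 \<pi> \<xi> \<pi>' \<xi>'.
    norm1 (dim_x S) (\<lambda>i. state S x0 \<pi> \<xi> t i - state S x0 \<pi>' \<xi>' t i)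
      \<le> K * input_gap S \<pi> \<xi> \<pi>' \<xi>'"
  using assms
proof (induction t)
  case 0
  show ?case by (rule exI[of _ 0]) (simp add: norm1_def)
next
  case (Suc t)
  then obtain K where K: "0 \<le> K" and IH: "\<And>x0 \<pi> \<xi> \<pi>' \<xi>'.
    norm1 (dim_x S) (\<lambda>i. state S x0 \<pi> \<xi> t i - state S x0 \<pi>' \<xi>' t i)
      \<le> K * input_gap S \<pi> \<xi> \<pi>' \<xi>'" by auto
  define a where "a = (\<Sum>i=1..dim_x S. \<Sum>k=1..dim_x S. \<bar>Amat S t i k\<bar>)"
  define b where "b = (\<Sum>i=1..dim_x S. \<Sum>k=1..dim_u S. \<bar>Bmat S t i k\<bar>)"
  define d where "d = (\<Sum>i=1..dim_x S. \<Sum>k=1..dim_xi S. \<bar>Dmat S t i k\<bar>)"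
  have nn: "0 \<le> a" "0 \<le> b" "0 \<le> d" by (simp_all add: a_def b_def d_def sum_nonneg)
  show ?case
  proof (rule exI[of _ "a * K + b + d"], intro conjI allI)
    show "0 \<le> a * K + b + d" using nn K by simp
    fix x0 \<pi> \<xi> \<pi>' \<xi>'
    let ?E = "input_gap S \<pi> \<xi> \<pi>' \<xi>'"
    let ?x = "\<lambda>k. state S x0 \<pi> \<xi> t k - state S x0 \<pi>' \<xi>' t k"
    let ?u = "\<lambda>k. control S \<pi> \<xi> t k - control S \<pi>' \<xi>' t k"
    let ?n = "\<lambda>k. noise \<xi> t k - noise \<xi>' t k"
    have t: "t \<le> horizon S" using Suc.prems by simp
    have un: "norm1 (dim_u S) ?u \<le> ?E" "norm1 (dim_xi S) ?n \<le> ?E"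
      using input_gap_upper[OF t, of \<pi> \<xi> \<pi>' \<xi>'] norm1_nonneg[of "dim_u S" ?u]
        norm1_nonneg[of "dim_xi S" ?n] by linarith+
    have "(\<lambda>i. state S x0 \<pi> \<xi> (Suc t) i - state S x0 \<pi>' \<xi>' (Suc t) i)
      = (\<lambda>i. ((\<Sum>k=1..dim_x S. Amat S t i k * ?x k) + (\<Sum>k=1..dim_u S. Bmat S t i k * ?u k))
        + (\<Sum>k=1..dim_xi S. Dmat S t i k * ?n k))"
      by (rule ext) (simp add: right_diff_distrib sum_subtractf)
    then have "norm1 (dim_x S) (\<lambda>i. state S x0 \<pi> \<xi> (Suc t) i - state S x0 \<pi>' \<xi>' (Suc t) i)
      \<le> norm1 (dim_x S) (\<lambda>i. \<Sum>k=1..dim_x S. Amat S t i k * ?x k)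
        + norm1 (dim_x S) (\<lambda>i. \<Sum>k=1..dim_u S. Bmat S t i k * ?u k)
        + norm1 (dim_x S) (\<lambda>i. \<Sum>k=1..dim_xi S. Dmat S t i k * ?n k)"
      by (simp only:) (intro order_trans[OF norm1_add] add_right_mono norm1_add)
    also have "\<dots> \<le> a * norm1 (dim_x S) ?x + b * norm1 (dim_u S) ?u + d * norm1 (dim_xi S) ?n"
      unfolding a_def b_def d_def by (intro add_mono norm1_matrix)
    also have "\<dots> \<le> a * (K * ?E) + b * ?E + d * ?E"
      using nn IH un by (intro add_mono mult_left_mono) auto
    also have "\<dots> = (a * K + b + d) * ?E" by (simp add: algebra_simps)
    finally show "norm1 (dim_x S) (\<lambda>i. state S x0 \<pi> \<xi> (Suc t) i - state S x0 \<pi>' \<xi>' (Suc t) i)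
      \<le> (a * K + b + d) * ?E" .
  qed
qed

lemma total_cost_gap:
  assumes Lc: "0 \<le> Lc"
  obtains K where "0 \<le> K"
    "\<And>x0 \<alpha> c \<pi> \<xi> \<pi>' \<xi>'. lipschitz_cost S Lc c \<Longrightarrow>
       (\<forall>t\<in>{1..horizon S}. 0 \<le> \<alpha> t \<and> \<alpha> t \<le> 1) \<Longrightarrow>
       \<bar>total_cost S x0 \<alpha> c \<pi> \<xi> - total_cost S x0 \<alpha> c \<pi>' \<xi>'\<bar> \<le> K * input_gap S \<pi> \<xi> \<pi>' \<xi>'"
proof -
  have "\<forall>t\<in>{..horizon S}. \<exists>K\<ge>0. \<forall>x0 \<pi> \<xi> \<pi>' \<xi>'.
    norm1 (dim_x S) (\<lambda>i. state S x0 \<pi> \<xi> t i - state S x0 \<pi>' \<xi>' t i)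
      \<le> K * input_gap S \<pi> \<xi> \<pi>' \<xi>'"
    using state_gap by simp
  from bchoice[OF this] obtain K where Kt: "\<forall>t\<in>{..horizon S}. 0 \<le> K t \<and> (\<forall>x0 \<pi> \<xi> \<pi>' \<xi>'.
    norm1 (dim_x S) (\<lambda>i. state S x0 \<pi> \<xi> t i - state S x0 \<pi>' \<xi>' t i)
      \<le> K t * input_gap S \<pi> \<xi> \<pi>' \<xi>')" ..
  then have K: "\<And>t. t \<le> horizon S \<Longrightarrow> 0 \<le> K t"
      "\<And>t x0 \<pi> \<xi> \<pi>' \<xi>'. t \<le> horizon S \<Longrightarrow>
        norm1 (dim_x S) (\<lambda>i. state S x0 \<pi> \<xi> t i - state S x0 \<pi>' \<xi>' t i)
          \<le> K t * input_gap S \<pi> \<xi> \<pi>' \<xi>'"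
    by simp_all
  show ?thesis
  proof (rule that[of "\<Sum>t=1..horizon S. Lc * (K t + 1)"])
    show "0 \<le> (\<Sum>t=1..horizon S. Lc * (K t + 1))"
      using K(1) Lc by (intro sum_nonneg mult_nonneg_nonneg) auto
    fix x0 \<pi> \<xi> \<pi>' \<xi>' and \<alpha> :: "nat \<Rightarrow> real" and c
    assume c: "lipschitz_cost S Lc c" and \<alpha>: "\<forall>t\<in>{1..horizon S}. 0 \<le> \<alpha> t \<and> \<alpha> t \<le> 1"
    let ?E = "input_gap S \<pi> \<xi> \<pi>' \<xi>'"
    let ?c = "\<lambda>\<pi> \<xi> t. c t (state S x0 \<pi> \<xi> t) (control S \<pi> \<xi> t)"
    have "\<bar>\<alpha> t * ?c \<pi> \<xi> t - \<alpha> t * ?c \<pi>' \<xi>' t\<bar> \<le> Lc * (K t + 1) * ?E"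
      if t: "t \<in> {1..horizon S}" for t
    proof -
      let ?u = "\<lambda>j. control S \<pi> \<xi> t j - control S \<pi>' \<xi>' t j"
      let ?x = "\<lambda>i. state S x0 \<pi> \<xi> t i - state S x0 \<pi>' \<xi>' t i"
      have t': "t \<le> horizon S" using t by simp
      have "norm1 (dim_u S) ?u \<le> ?E"
        using input_gap_upper[OF t', of \<pi> \<xi> \<pi>' \<xi>']
          norm1_nonneg[of "dim_xi S" "\<lambda>i. noise \<xi> t i - noise \<xi>' t i"] by linarith
      then have "norm1 (dim_x S) ?x + norm1 (dim_u S) ?u \<le> (K t + 1) * ?E"
        using K(2)[OF t', of x0 \<pi> \<xi> \<pi>' \<xi>'] by (simp add: distrib_right)
      moreover have "\<bar>?c \<pi> \<xi> t - ?c \<pi>' \<xi>' t\<bar> \<le> Lc * (norm1 (dim_x S) ?x + norm1 (dim_u S) ?u)"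
        using c t unfolding lipschitz_cost_def by blast
      ultimately have "\<bar>?c \<pi> \<xi> t - ?c \<pi>' \<xi>' t\<bar> \<le> Lc * ((K t + 1) * ?E)"
        using Lc by (meson mult_left_mono order_trans)
      moreover have "\<bar>\<alpha> t * ?c \<pi> \<xi> t - \<alpha> t * ?c \<pi>' \<xi>' t\<bar> = \<alpha> t * \<bar>?c \<pi> \<xi> t - ?c \<pi>' \<xi>' t\<bar>"
        using \<alpha> t by (simp add: right_diff_distrib[symmetric] abs_mult)
      moreover have "\<alpha> t * \<bar>?c \<pi> \<xi> t - ?c \<pi>' \<xi>' t\<bar> \<le> \<bar>?c \<pi> \<xi> t - ?c \<pi>' \<xi>' t\<bar>"
        using \<alpha> t by (intro mult_left_le_one_le) auto
      ultimately show ?thesis by (simp add: mult.assoc)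
    qed
    then show "\<bar>total_cost S x0 \<alpha> c \<pi> \<xi> - total_cost S x0 \<alpha> c \<pi>' \<xi>'\<bar>
        \<le> (\<Sum>t=1..horizon S. Lc * (K t + 1)) * ?E"
      unfolding total_cost_def sum_subtractf[symmetric] sum_distrib_right
      by (intro order_trans[OF sum_abs] sum_mono)
  qed
qed

section \<open>Integrability of the total cost\<close>

lemma hist_in_hist_support:
  assumes "\<xi> \<in> hist_support S l v (horizon S)" "t \<le> horizon S"
  shows "hist S \<xi> t \<in> hist_support S l v t"
  using assms by (auto simp: hist_support_iff hist_def hist_index_def)

lemma input_gap_same_policy:
  assumes \<pi>: "\<pi> \<in> lipschitz_policies S l v L" and L: "0 \<le> L"
    and \<xi>: "\<xi> \<in> hist_support S l v (horizon S)" "\<xi>' \<in> hist_support S l v (horizon S)"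
  shows "input_gap S \<pi> \<xi> \<pi> \<xi>' \<le> (real (horizon S) * (real (dim_u S) * L) + 1)
    * (\<Sum>z\<in>hist_index S (horizon S). \<bar>\<xi> z - \<xi>' z\<bar>)"
proof -
  let ?D = "\<Sum>z\<in>hist_index S (horizon S). \<bar>\<xi> z - \<xi>' z\<bar>"
  have "norm1 (dim_u S) (\<lambda>j. control S \<pi> \<xi> t j - control S \<pi> \<xi>' t j) \<le> real (dim_u S) * (L * ?D)"
    if t: "t \<in> {1..horizon S}" for t
  proof -
    have "\<bar>control S \<pi> \<xi> t j - control S \<pi> \<xi>' t j\<bar> \<le> L * ?D" if j: "j \<in> {1..dim_u S}" for j
    proof -
      have "\<bar>\<pi> t (hist S \<xi> t) j - \<pi> t (hist S \<xi>' t) j\<bar>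
          \<le> L * (\<Sum>z\<in>hist_index S t. \<bar>hist S \<xi> t z - hist S \<xi>' t z\<bar>)"
        using \<pi> t j hist_in_hist_support[OF \<xi>(1)] hist_in_hist_support[OF \<xi>(2)]
        by (simp add: lipschitz_policies_def)
      also have "(\<Sum>z\<in>hist_index S t. \<bar>hist S \<xi> t z - hist S \<xi>' t z\<bar>)
          = (\<Sum>z\<in>hist_index S t. \<bar>\<xi> z - \<xi>' z\<bar>)"
        by (intro sum.cong) (auto simp: hist_def)
      also have "L * \<dots> \<le> L * ?D"
        using L t by (intro mult_left_mono sum_mono2) (auto simp: hist_index_def)
      finally show ?thesis using t by (simp add: control_def)
    qed
    then have "norm1 (dim_u S) (\<lambda>j. control S \<pi> \<xi> t j - control S \<pi> \<xi>' t j)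
        \<le> (\<Sum>j=1..dim_u S. L * ?D)"
      unfolding norm1_def by (rule sum_mono)
    then show ?thesis by simp
  qed
  then have "(\<Sum>t=1..horizon S. norm1 (dim_u S) (\<lambda>j. control S \<pi> \<xi> t j - control S \<pi> \<xi>' t j))
      \<le> (\<Sum>t=1..horizon S. real (dim_u S) * (L * ?D))"
    by (rule sum_mono)
  moreover have "(\<Sum>t=1..horizon S. norm1 (dim_xi S) (\<lambda>i. noise \<xi> t i - noise \<xi>' t i)) = ?D"
  proof -
    have "(\<Sum>t=1..horizon S. norm1 (dim_xi S) (\<lambda>i. noise \<xi> t i - noise \<xi>' t i))
        = (\<Sum>t=1..horizon S. \<Sum>i=1..dim_xi S. \<bar>\<xi> (t, i) - \<xi>' (t, i)\<bar>)"
      unfolding norm1_def by (intro sum.cong refl) (simp add: noise_def)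
    then show ?thesis unfolding sum_hist_index by simp
  qed
  ultimately show ?thesis by (simp add: input_gap_def sum.distrib distrib_right)
qed

text \<open>
  The Lipschitz bound makes \<open>F\<close> continuous for the product topology on all functions of a pair of
  indices, whose Borel sets are those of the full countable product.  The finite product embeds
  measurably into it, since the coordinates outside the index set are constant on its space.
\<close>

lemma measurable_lipschitz_on_support:
  fixes F :: "disturbance \<Rightarrow> real"
  assumes lip: "\<And>\<xi> \<xi>'. \<xi> \<in> hist_support S l v T \<Longrightarrow> \<xi>' \<in> hist_support S l v T \<Longrightarrow>
      \<bar>F \<xi> - F \<xi>'\<bar> \<le> K * (\<Sum>z\<in>hist_index S T. \<bar>\<xi> z - \<xi>' z\<bar>)"
  shows "F \<in> borel_measurable
    (restrict_space (PiM (hist_index S T) (\<lambda>_. borel)) (hist_support S l v T))"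
proof -
  let ?H = "hist_support S l v T" and ?P = "PiM (hist_index S T) (\<lambda>_. borel :: real measure)"
  have cont: "continuous_on ?H F"
    unfolding continuous_on_def
  proof
    fix \<xi> assume \<xi>: "\<xi> \<in> ?H"
    have coord: "((\<lambda>\<xi>'. \<xi>' z) \<longlongrightarrow> \<xi> z) (at \<xi> within ?H)" for z
      using continuous_on_product_coordinates[of z] \<xi>
      by (metis continuous_on_def continuous_on_subset subset_UNIV)
    have "((\<lambda>\<xi>'. K * (\<Sum>z\<in>hist_index S T. \<bar>\<xi>' z - \<xi> z\<bar>)) \<longlongrightarrow>
        K * (\<Sum>z\<in>hist_index S T. \<bar>\<xi> z - \<xi> z\<bar>)) (at \<xi> within ?H)"
      by (intro tendsto_intros coord)
    then have bound: "((\<lambda>\<xi>'. K * (\<Sum>z\<in>hist_index S T. \<bar>\<xi>' z - \<xi> z\<bar>)) \<longlongrightarrow> 0) (at \<xi> within ?H)"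
      by simp
    have "\<forall>\<^sub>F \<xi>' in at \<xi> within ?H. \<xi>' \<in> ?H" by (simp add: eventually_at_filter)
    then have "\<forall>\<^sub>F \<xi>' in at \<xi> within ?H.
        norm (F \<xi>' - F \<xi>) \<le> K * (\<Sum>z\<in>hist_index S T. \<bar>\<xi>' z - \<xi> z\<bar>)"
      by (rule eventually_mono) (simp only: real_norm_def lip \<xi>)
    then have "((\<lambda>\<xi>'. F \<xi>' - F \<xi>) \<longlongrightarrow> 0) (at \<xi> within ?H)"
      using bound by (rule Lim_null_comparison)
    then show "(F \<longlongrightarrow> F \<xi>) (at \<xi> within ?H)" by (rule LIM_zero_cancel)
  qed
  have "(\<lambda>\<xi>. \<xi>) \<in> measurable ?P (PiM UNIV (\<lambda>_. borel))"
  proof (rule measurable_PiM_single')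
    fix z :: "nat \<times> nat"
    show "(\<lambda>\<xi>. \<xi> z) \<in> borel_measurable ?P"
    proof (cases "z \<in> hist_index S T")
      case False
      then have "\<xi> z = undefined" if "\<xi> \<in> space ?P" for \<xi>
        using that by (simp add: space_PiM PiE_arb[OF _ False])
      then show ?thesis using measurable_cong[of ?P "\<lambda>\<xi>. \<xi> z" "\<lambda>_. undefined" borel] by simp
    qed measurable
  qed auto
  then have "(\<lambda>\<xi>. \<xi>) \<in> measurable ?P (borel :: disturbance measure)"
    using measurable_cong_sets[OF refl sets_PiM_equal_borel] by blast
  then have "(\<lambda>\<xi>. \<xi>) \<in> measurable (restrict_space ?P ?H) (restrict_space borel ?H)"
    by (intro measurable_restrict_space3) auto
  from measurable_compose[OF this borel_measurable_continuous_on_restrict[OF cont]]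
  show ?thesis by simp
qed

lemma space_of_support_measure:
  assumes "sets P = sets (restrict_space (PiM (hist_index S T) (\<lambda>_. borel)) (hist_support S l v T))"
  shows "space P = hist_support S l v T"
proof -
  have "hist_support S l v T \<subseteq> space (PiM (hist_index S T) (\<lambda>_. borel))"
    by (auto simp: hist_support_def space_PiM PiE_def)
  then show ?thesis
    using sets_eq_imp_space_eq[OF assms] by (auto simp: space_restrict_space)
qed

lemma integrable_lipschitz_on_support:
  fixes F :: "disturbance \<Rightarrow> real"
  assumes lip: "\<And>\<xi> \<xi>'. \<xi> \<in> hist_support S l v T \<Longrightarrow> \<xi>' \<in> hist_support S l v T \<Longrightarrow>
      \<bar>F \<xi> - F \<xi>'\<bar> \<le> K * (\<Sum>z\<in>hist_index S T. \<bar>\<xi> z - \<xi>' z\<bar>)" and K: "0 \<le> K"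
    and P: "prob_space P"
      "sets P = sets (restrict_space (PiM (hist_index S T) (\<lambda>_. borel)) (hist_support S l v T))"
  shows "integrable P F"
proof -
  interpret prob_space P by fact
  note sp = space_of_support_measure[OF P(2)]
  obtain \<xi>0 where \<xi>0: "\<xi>0 \<in> hist_support S l v T" using not_empty sp by auto
  have "\<bar>F \<xi>\<bar> \<le> \<bar>F \<xi>0\<bar> + K * (\<Sum>z\<in>hist_index S T. v (fst z) (snd z) - l (fst z) (snd z))"
    if \<xi>: "\<xi> \<in> hist_support S l v T" for \<xi>
  proof -
    have "(\<Sum>z\<in>hist_index S T. \<bar>\<xi> z - \<xi>0 z\<bar>)
        \<le> (\<Sum>z\<in>hist_index S T. v (fst z) (snd z) - l (fst z) (snd z))"
    proof (rule sum_mono)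
      fix z assume "z \<in> hist_index S T"
      then have "\<xi> z \<in> {l (fst z) (snd z)..v (fst z) (snd z)}"
        "\<xi>0 z \<in> {l (fst z) (snd z)..v (fst z) (snd z)}"
        using \<xi> \<xi>0 by (auto simp: hist_support_iff)
      then show "\<bar>\<xi> z - \<xi>0 z\<bar> \<le> v (fst z) (snd z) - l (fst z) (snd z)" by auto
    qed
    then have "K * (\<Sum>z\<in>hist_index S T. \<bar>\<xi> z - \<xi>0 z\<bar>)
        \<le> K * (\<Sum>z\<in>hist_index S T. v (fst z) (snd z) - l (fst z) (snd z))"
      using K by (rule mult_left_mono)
    then show ?thesis using lip[OF \<xi> \<xi>0] by linarith
  qed
  moreover have "F \<in> borel_measurable P"
    using measurable_lipschitz_on_support[of S l v T F K, OF lip] measurable_cong_sets[OF P(2) refl]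
    by blast
  ultimately show ?thesis
    by (intro integrable_const_bound[where B =
        "\<bar>F \<xi>0\<bar> + K * (\<Sum>z\<in>hist_index S T. v (fst z) (snd z) - l (fst z) (snd z))"])
      (auto simp: sp intro!: AE_I2)
qed

lemma total_cost_lipschitz:
  assumes Lc: "0 \<le> Lc" and c: "lipschitz_cost S Lc c"
    and \<alpha>: "\<forall>t\<in>{1..horizon S}. 0 \<le> \<alpha> t \<and> \<alpha> t \<le> 1"
    and \<pi>: "\<pi> \<in> lipschitz_policies S l v L" and L: "0 \<le> L"
  obtains K where "0 \<le> K"
    "\<And>\<xi> \<xi>'. \<xi> \<in> hist_support S l v (horizon S) \<Longrightarrow> \<xi>' \<in> hist_support S l v (horizon S) \<Longrightarrow>
      \<bar>total_cost S x0 \<alpha> c \<pi> \<xi> - total_cost S x0 \<alpha> c \<pi> \<xi>'\<bar>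
        \<le> K * (\<Sum>z\<in>hist_index S (horizon S). \<bar>\<xi> z - \<xi>' z\<bar>)"
proof -
  obtain K where K: "0 \<le> K" "\<And>\<xi> \<xi>'.
       \<bar>total_cost S x0 \<alpha> c \<pi> \<xi> - total_cost S x0 \<alpha> c \<pi> \<xi>'\<bar> \<le> K * input_gap S \<pi> \<xi> \<pi> \<xi>'"
    using total_cost_gap[OF Lc] c \<alpha> by metis
  show ?thesis
  proof (rule that[of "K * (real (horizon S) * (real (dim_u S) * L) + 1)"])
    show "0 \<le> K * (real (horizon S) * (real (dim_u S) * L) + 1)" using K L by simp
    fix \<xi> \<xi>' assume "\<xi> \<in> hist_support S l v (horizon S)" "\<xi>' \<in> hist_support S l v (horizon S)"
    from mult_left_mono[OF input_gap_same_policy[OF \<pi> L this] K(1)] K(2)[of \<xi> \<xi>']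
    show "\<bar>total_cost S x0 \<alpha> c \<pi> \<xi> - total_cost S x0 \<alpha> c \<pi> \<xi>'\<bar>
        \<le> K * (real (horizon S) * (real (dim_u S) * L) + 1)
          * (\<Sum>z\<in>hist_index S (horizon S). \<bar>\<xi> z - \<xi>' z\<bar>)"
      by (simp only: mult.assoc)
  qed
qed


section \<open>Comparison of the optimal values\<close>

lemma largest_segment_nonneg:
  assumes "wf_system S" "breakpoints S l v p w"
  shows "0 \<le> largest_segment S p w"
proof -
  have *: "1 \<in> {1..horizon S}" "1 \<in> {1..dim_xi S}"
    using assms(1) by (auto simp: wf_system_def)
  then have z: "(1, 1) \<in> hist_index S (horizon S)" by (simp add: hist_index_def)
  have "1 \<in> {1..p 1 1}" "w 1 1 (1 - 1) \<le> w 1 1 1"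
    using breakpointsD(2)[OF assms(2) order.refl z]
      nodes_mono[OF breakpointsD(1)[OF assms(2) order.refl z], of 0 1] by auto
  then show ?thesis using largest_segment_upper[OF *, of 1 p w] by linarith
qed

lemma input_gap_same_disturbance:
  assumes \<xi>: "\<xi> \<in> hist_support S l v (horizon S)" and b: "0 \<le> b"
    and close: "\<And>t j \<eta>. t \<in> {1..horizon S} \<Longrightarrow> j \<in> {1..dim_u S} \<Longrightarrow> \<eta> \<in> hist_support S l v t \<Longrightarrow>
       \<bar>\<pi> t \<eta> j - \<pi>' t \<eta> j\<bar> \<le> real (t * dim_xi S) * b"
  shows "input_gap S \<pi>' \<xi> \<pi> \<xi>
    \<le> real (horizon S) * (real (dim_u S) * (real (horizon S * dim_xi S) * b))"
proof -
  have "norm1 (dim_u S) (\<lambda>j. control S \<pi>' \<xi> t j - control S \<pi> \<xi> t j)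
      + norm1 (dim_xi S) (\<lambda>i. noise \<xi> t i - noise \<xi> t i)
      \<le> real (dim_u S) * (real (horizon S * dim_xi S) * b)" if t: "t \<in> {1..horizon S}" for t
  proof -
    have "\<bar>control S \<pi>' \<xi> t j - control S \<pi> \<xi> t j\<bar> \<le> real (horizon S * dim_xi S) * b"
      if j: "j \<in> {1..dim_u S}" for j
    proof -
      have "\<bar>\<pi> t (hist S \<xi> t) j - \<pi>' t (hist S \<xi> t) j\<bar> \<le> real (t * dim_xi S) * b"
        using t hist_in_hist_support[OF \<xi>, of t] by (intro close j) auto
      also have "\<dots> \<le> real (horizon S * dim_xi S) * b"
        using t b by (intro mult_right_mono) (auto simp del: of_nat_mult)
      finally show ?thesis using t by (simp add: control_def abs_minus_commute)
    qed
    then have "norm1 (dim_u S) (\<lambda>j. control S \<pi>' \<xi> t j - control S \<pi> \<xi> t j)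
        \<le> (\<Sum>j=1..dim_u S. real (horizon S * dim_xi S) * b)"
      unfolding norm1_def by (rule sum_mono)
    then show ?thesis by (simp add: norm1_def)
  qed
  then have "input_gap S \<pi>' \<xi> \<pi> \<xi>
      \<le> (\<Sum>t=1..horizon S. real (dim_u S) * (real (horizon S * dim_xi S) * b))"
    unfolding input_gap_def by (rule sum_mono)
  then show ?thesis by simp
qed

lemma optimal_value_total_cost:
  "optimal_value S x0 \<alpha> c \<B> \<CC> Pol
    = (INF \<pi>\<in>Pol \<inter> \<CC>. SUP P\<in>\<B>. ereal (\<integral>\<xi>. total_cost S x0 \<alpha> c \<pi> \<xi> \<partial>P))"
  by (simp add: optimal_value_def total_cost_def)

lemma integrable_total_cost:
  assumes "0 \<le> Lc" "lipschitz_cost S Lc c" "\<forall>t\<in>{1..horizon S}. 0 \<le> \<alpha> t \<and> \<alpha> t \<le> 1"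
    and "\<pi> \<in> lipschitz_policies S l v L" "0 \<le> L" "ambiguity_set S l v \<B>" "P \<in> \<B>"
  shows "integrable P (total_cost S x0 \<alpha> c \<pi>)"
proof -
  obtain K where K: "0 \<le> K"
    "\<And>\<xi> \<xi>'. \<xi> \<in> hist_support S l v (horizon S) \<Longrightarrow> \<xi>' \<in> hist_support S l v (horizon S) \<Longrightarrow>
      \<bar>total_cost S x0 \<alpha> c \<pi> \<xi> - total_cost S x0 \<alpha> c \<pi> \<xi>'\<bar>
        \<le> K * (\<Sum>z\<in>hist_index S (horizon S). \<bar>\<xi> z - \<xi>' z\<bar>)"
    using total_cost_lipschitz[OF assms(1-5)] by metis
  have "prob_space P" "sets P = sets (restrict_space (PiM (hist_index S (horizon S)) (\<lambda>_. borel))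
                                      (hist_support S l v (horizon S)))"
    using assms(6,7) by (auto simp: ambiguity_set_def)
  with K show ?thesis by (intro integrable_lipschitz_on_support[of S l v "horizon S" _ K])
qed

text \<open>
  \<open>C\<close> is chosen before the support, the costs, the ambiguity set, the ball and the breakpoints.
  Interpolation maps every feasible additive policy to a feasible lifted one whose cost is larger by at
  most \<open>C * largest_segment S p w\<close> for every disturbance; this passes to the expectations, to their
  supremum over the ambiguity set and to the infimum over the policies.
\<close>

lemma value_lifted_le_value_additive:
  assumes Lc: "0 \<le> Lc" and L: "0 \<le> L"
  shows "\<exists>C\<ge>0. \<forall>l v x0 \<alpha> c \<B> \<pi>0 \<rho> p w. hypotheses S l v \<alpha> Lc c \<B> \<pi>0 \<rho> p w \<longrightarrow>
       value_lifted S l v x0 \<alpha> c \<B> \<pi>0 \<rho> p w L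
         \<le> value_additive S l v x0 \<alpha> c \<B> \<pi>0 \<rho> L + ereal (C * largest_segment S p w)"
proof -
  obtain K where K: "0 \<le> K"
    "\<And>x0 \<alpha> c \<pi> \<xi> \<pi>' \<xi>'. lipschitz_cost S Lc c \<Longrightarrow>
       (\<forall>t\<in>{1..horizon S}. 0 \<le> \<alpha> t \<and> \<alpha> t \<le> 1) \<Longrightarrow>
       \<bar>total_cost S x0 \<alpha> c \<pi> \<xi> - total_cost S x0 \<alpha> c \<pi>' \<xi>'\<bar> \<le> K * input_gap S \<pi> \<xi> \<pi>' \<xi>'"
    using total_cost_gap[OF Lc] by blast
  define C where
    "C = K * (real (horizon S) * (real (dim_u S) * (real (horizon S * dim_xi S) * (2 * L))))"
  show ?thesis
  proof (intro exI[of _ C] conjI allI impI)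
    show "0 \<le> C" using K(1) L by (simp add: C_def)
    fix l v x0 \<alpha> c \<B> \<pi>0 \<rho> p w assume H: "hypotheses S l v \<alpha> Lc c \<B> \<pi>0 \<rho> p w"
    have bp: "breakpoints S l v p w" and c: "lipschitz_cost S Lc c"
      and \<alpha>: "\<forall>t\<in>{1..horizon S}. 0 \<le> \<alpha> t \<and> \<alpha> t \<le> 1" and \<B>: "ambiguity_set S l v \<B>"
      and \<pi>0: "\<pi>0 \<in> lifted_policies S l v p w" and wf: "wf_system S"
      using H by (simp_all add: hypotheses_def)
    let ?\<epsilon> = "largest_segment S p w"
    let ?J = "\<lambda>\<pi>. SUP P\<in>\<B>. ereal (\<integral>\<xi>. total_cost S x0 \<alpha> c \<pi> \<xi> \<partial>P)"
    \<comment> \<open>The error is moved to the left, because the infimum on the right may be \<open>\<infinity>\<close>.\<close>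
    have "value_lifted S l v x0 \<alpha> c \<B> \<pi>0 \<rho> p w L - ereal (C * ?\<epsilon>) \<le> ?J \<pi>"
      if \<pi>: "\<pi> \<in> additive_policies S l v \<inter> lipschitz_policies S l v L \<inter> policy_ball S l v \<pi>0 \<rho>" for \<pi>
    proof -
      have \<pi>_in: "\<pi> \<in> additive_policies S l v" "\<pi> \<in> lipschitz_policies S l v L"
        "\<pi> \<in> policy_ball S l v \<pi>0 \<rho>"
        using \<pi> by simp_all
      obtain \<pi>' where \<pi>': "\<pi>' \<in> lifted_policies S l v p w" "\<pi>' \<in> lipschitz_policies S l v L"
        "\<pi>' \<in> policy_ball S l v \<pi>0 \<rho>"
        and close: "\<forall>t\<in>{1..horizon S}. \<forall>j\<in>{1..dim_u S}. \<forall>\<xi>\<in>hist_support S l v t.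
          \<bar>\<pi> t \<xi> j - \<pi>' t \<xi> j\<bar> \<le> real (t * dim_xi S) * (2 * L * ?\<epsilon>)"
        by (rule lifted_policy_approximation[OF bp L \<pi>_in \<pi>0])
      have b: "0 \<le> 2 * L * ?\<epsilon>" using L largest_segment_nonneg[OF wf bp] by simp
      have pointwise: "total_cost S x0 \<alpha> c \<pi>' \<xi> \<le> total_cost S x0 \<alpha> c \<pi> \<xi> + C * ?\<epsilon>"
        if \<xi>: "\<xi> \<in> hist_support S l v (horizon S)" for \<xi>
      proof -
        have "\<bar>total_cost S x0 \<alpha> c \<pi>' \<xi> - total_cost S x0 \<alpha> c \<pi> \<xi>\<bar> \<le> K * input_gap S \<pi>' \<xi> \<pi> \<xi>"
          by (rule K(2)[OF c \<alpha>])
        also have "\<dots> \<le> K * (real (horizon S) * (real (dim_u S) * (real (horizon S * dim_xi S) * (2 * L * ?\<epsilon>))))"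
          by (intro mult_left_mono K(1) input_gap_same_disturbance[OF \<xi> b]
              close[rule_format])
        also have "\<dots> = C * ?\<epsilon>" by (simp add: C_def)
        finally show ?thesis by linarith
      qed
      have "value_lifted S l v x0 \<alpha> c \<B> \<pi>0 \<rho> p w L \<le> ?J \<pi>'"
        unfolding value_lifted_def optimal_value_total_cost using \<pi>' by (intro INF_lower) simp
      also have "\<dots> \<le> ?J \<pi> + ereal (C * ?\<epsilon>)"
      proof (rule SUP_least)
        fix P assume P: "P \<in> \<B>"
        then interpret prob_space P using \<B> by (simp add: ambiguity_set_def)
        have sp: "space P = hist_support S l v (horizon S)"
          using \<B> P by (intro space_of_support_measure) (simp add: ambiguity_set_def)
        have int: "integrable P (total_cost S x0 \<alpha> c \<pi>)" "integrable P (total_cost S x0 \<alpha> c \<pi>')"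
          using integrable_total_cost[OF Lc c \<alpha> _ L \<B> P] \<pi>_in(2) \<pi>'(2) by simp_all
        have "(\<integral>\<xi>. total_cost S x0 \<alpha> c \<pi>' \<xi> \<partial>P) \<le> (\<integral>\<xi>. total_cost S x0 \<alpha> c \<pi> \<xi> + C * ?\<epsilon> \<partial>P)"
          using int pointwise sp by (intro integral_mono) auto
        also have "\<dots> = (\<integral>\<xi>. total_cost S x0 \<alpha> c \<pi> \<xi> \<partial>P) + C * ?\<epsilon>"
          using int by (simp add: prob_space)
        finally have "ereal (\<integral>\<xi>. total_cost S x0 \<alpha> c \<pi>' \<xi> \<partial>P)
            \<le> ereal (\<integral>\<xi>. total_cost S x0 \<alpha> c \<pi> \<xi> \<partial>P) + ereal (C * ?\<epsilon>)" by simp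
        also have "\<dots> \<le> ?J \<pi> + ereal (C * ?\<epsilon>)"
          by (intro add_right_mono SUP_upper P)
        finally show "ereal (\<integral>\<xi>. total_cost S x0 \<alpha> c \<pi>' \<xi> \<partial>P) \<le> ?J \<pi> + ereal (C * ?\<epsilon>)" .
      qed
      finally show ?thesis by (simp add: ereal_minus_le)
    qed
    then have "value_lifted S l v x0 \<alpha> c \<B> \<pi>0 \<rho> p w L - ereal (C * ?\<epsilon>)
        \<le> value_additive S l v x0 \<alpha> c \<B> \<pi>0 \<rho> L"
      unfolding value_additive_def optimal_value_total_cost by (rule INF_greatest)
    then show "value_lifted S l v x0 \<alpha> c \<B> \<pi>0 \<rho> p w L
         \<le> value_additive S l v x0 \<alpha> c \<B> \<pi>0 \<rho> L + ereal (C * ?\<epsilon>)"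
      by (simp add: ereal_minus_le)
  qed
qed

lemma largest_segment_least:
  assumes "wf_system S" "breakpoints S l v p w"
    and B: "\<And>t i k. t \<in> {1..horizon S} \<Longrightarrow> i \<in> {1..dim_xi S} \<Longrightarrow> k \<in> {1..p t i} \<Longrightarrow>
      w t i k - w t i (k - 1) \<le> B"
  shows "largest_segment S p w \<le> B"
  unfolding largest_segment_def
proof (rule Max.boundedI[OF finite_segments])
  let ?A = "{w t i k - w t i (k - 1) | t i k.
     t \<in> {1..horizon S} \<and> i \<in> {1..dim_xi S} \<and> k \<in> {1..p t i}}"
  have "1 \<in> {1..horizon S}" "1 \<in> {1..dim_xi S}" "1 \<in> {1..p 1 1}"
    using assms(1,2) by (auto simp: wf_system_def breakpoints_def)
  then have "w 1 1 1 - w 1 1 (1 - 1) \<in> ?A"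
    by (intro CollectI exI conjI) (rule refl)
  then show "?A \<noteq> {}" by blast
  show "x \<le> B" if "x \<in> ?A" for x
    using that by (elim CollectE exE conjE) (simp only: B)
qed

lemma largest_segment_equal_segments:
  assumes S: "wf_system S" "wf_support S l v" and n: "1 \<le> n"
    and bp: "breakpoints S l v p w" and eq: "equal_segments S l v n p w"
  shows "largest_segment S p w
    \<le> (\<Sum>z\<in>hist_index S (horizon S). v (fst z) (snd z) - l (fst z) (snd z)) / real n"
proof (rule largest_segment_least[OF S(1) bp])
  fix t i k assume *: "t \<in> {1..horizon S}" "i \<in> {1..dim_xi S}" "k \<in> {1..p t i}"
  have "v t i - l t i \<le> (\<Sum>z\<in>hist_index S (horizon S). v (fst z) (snd z) - l (fst z) (snd z))"
  proof -
    have nn: "0 \<le> v (fst z) (snd z) - l (fst z) (snd z)" if "z \<in> hist_index S (horizon S)" for z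
    proof -
      have "fst z \<in> {1..horizon S}" "snd z \<in> {1..dim_xi S}"
        using that by (auto simp: hist_index_def)
      then show ?thesis using S(2) unfolding wf_support_def by (simp add: less_imp_le)
    qed
    have "(t, i) \<in> hist_index S (horizon S)" using * by (simp add: hist_index_def)
    from member_le_sum[OF this, of "\<lambda>z. v (fst z) (snd z) - l (fst z) (snd z)"] nn
    show ?thesis by simp
  qed
  moreover have "w t i k - w t i (k - 1) = (v t i - l t i) / real n"
    using eq * unfolding equal_segments_def by simp
  ultimately show "w t i k - w t i (k - 1)
      \<le> (\<Sum>z\<in>hist_index S (horizon S). v (fst z) (snd z) - l (fst z) (snd z)) / real n"
    using n by (simp add: divide_right_mono)
qed

section \<open>Tightness\<close>

text \<open>
  The only effect of the dynamics is that the state at stage \<open>2\<close> equals the disturbance of stage \<open>1\<close>, so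
  that a cost of the second stage can depend on that disturbance.
\<close>

definition tight_system :: lin_system where
  "tight_system = \<lparr>horizon = 2, dim_x = 1, dim_u = 1, dim_xi = 1,
     Amat = (\<lambda>_ _ _. 0), Bmat = (\<lambda>_ _ _. 0), Dmat = (\<lambda>_ _ _. 1)\<rparr>"

text \<open>
  The target \<open>L * \<bar>x\<bar>\<close> is \<open>L\<close>-Lipschitz, so \<open>\<bar>u - L * \<bar>x\<bar>\<bar>\<close> is \<open>(1 + L)\<close>-Lipschitz; the factor brings
  the constant down to \<open>Lc\<close>.
\<close>

definition tight_cost :: "real \<Rightarrow> real \<Rightarrow> cost" where
  "tight_cost Lc L t x u = (if t = 2 then Lc / (1 + L) * \<bar>u 1 - L * \<bar>x 1\<bar>\<bar> else 0)"

abbreviation cube :: "nat \<Rightarrow> disturbance set" where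
  "cube \<equiv> hist_support tight_system (\<lambda>_ _. -1) (\<lambda>_ _. 1)"

definition scenario :: "real \<Rightarrow> disturbance" where
  "scenario x = restrict (\<lambda>z. if z = (1, 1) then x else 0) (hist_index tight_system 2)"

definition dirac :: "real \<Rightarrow> disturbance measure" where
  "dirac x = return (restrict_space (PiM (hist_index tight_system 2) (\<lambda>_. borel)) (cube 2)) (scenario x)"

definition grid :: "nat \<Rightarrow> nat \<Rightarrow> nat \<Rightarrow> nat \<Rightarrow> real" where
  "grid n t i k = -1 + 2 * real k / real n"

lemma tight_system_simps [simp]:
  "horizon tight_system = 2" "dim_x tight_system = 1" "dim_u tight_system = 1"
  "dim_xi tight_system = 1" "Amat tight_system t i k = 0" "Bmat tight_system t i k = 0"
  "Dmat tight_system t i k = 1"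
  by (simp_all add: tight_system_def)

lemma tight_indices: "{1..2::nat} = {1, 2}" "{1..1::nat} = {1}"
  by auto

lemma hist_index_tight: "hist_index tight_system 2 = {(1, 1), (2, 1)}"
  by (auto simp: hist_index_def)

lemma scenario_1: "scenario x (1, 1) = x"
  by (simp add: scenario_def hist_index_tight)

lemma scenario_in_cube: "\<bar>x\<bar> \<le> 1 \<Longrightarrow> scenario x \<in> cube 2"
  by (auto simp: hist_support_iff scenario_def hist_index_tight)

lemma tight_total_cost:
  assumes "\<xi> \<in> cube 2"
  shows "total_cost tight_system (\<lambda>_. 0) (\<lambda>_. 1) (tight_cost Lc L) \<pi> \<xi>
    = Lc / (1 + L) * \<bar>\<pi> 2 \<xi> 1 - L * \<bar>\<xi> (1, 1)\<bar>\<bar>"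
proof -
  have "hist tight_system \<xi> 2 = \<xi>"
    using assms by (auto simp: hist_support_iff hist_def extensional_restrict)
  moreover have "state tight_system (\<lambda>_. 0) \<pi> \<xi> 2 1 = \<xi> (1, 1)"
    by (simp add: numeral_2_eq_2 noise_def)
  ultimately show ?thesis
    unfolding total_cost_def tight_system_simps tight_indices
    by (simp add: tight_cost_def control_def)
qed

lemma lipschitz_tight_cost:
  assumes "0 < Lc" "0 < L"
  shows "lipschitz_cost tight_system Lc (tight_cost Lc L)"
  unfolding lipschitz_cost_def
proof (intro ballI allI)
  fix t and x u x' u' :: rvec
  have N: "norm1 1 y = \<bar>y 1\<bar>" for y :: rvec by (simp add: norm1_def)
  have scale: "\<bar>Lc / (1 + L) * a - Lc / (1 + L) * b\<bar> = Lc / (1 + L) * \<bar>a - b\<bar>" for a b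
    using assms unfolding right_diff_distrib[symmetric] abs_mult by simp
  have "\<bar>\<bar>u 1 - L * \<bar>x 1\<bar>\<bar> - \<bar>u' 1 - L * \<bar>x' 1\<bar>\<bar>\<bar> \<le> \<bar>u 1 - u' 1\<bar> + \<bar>L * \<bar>x 1\<bar> - L * \<bar>x' 1\<bar>\<bar>"
    by linarith
  also have "\<bar>L * \<bar>x 1\<bar> - L * \<bar>x' 1\<bar>\<bar> = L * \<bar>\<bar>x 1\<bar> - \<bar>x' 1\<bar>\<bar>"
    using assms by (simp add: right_diff_distrib[symmetric] abs_mult)
  also have "\<bar>u 1 - u' 1\<bar> + \<dots> \<le> \<bar>u 1 - u' 1\<bar> + L * \<bar>x 1 - x' 1\<bar>"
    using assms by (intro add_left_mono mult_left_mono abs_triangle_ineq3) simp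
  also have "\<dots> \<le> (1 + L) * (\<bar>x 1 - x' 1\<bar> + \<bar>u 1 - u' 1\<bar>)"
    using assms by (simp add: algebra_simps)
  finally have "Lc / (1 + L) * \<bar>\<bar>u 1 - L * \<bar>x 1\<bar>\<bar> - \<bar>u' 1 - L * \<bar>x' 1\<bar>\<bar>\<bar>
      \<le> Lc / (1 + L) * ((1 + L) * (\<bar>x 1 - x' 1\<bar> + \<bar>u 1 - u' 1\<bar>))"
    using assms by (intro mult_left_mono) auto
  also have "\<dots> = Lc * (\<bar>x 1 - x' 1\<bar> + \<bar>u 1 - u' 1\<bar>)" using assms by simp
  finally have "\<bar>Lc / (1 + L) * \<bar>u 1 - L * \<bar>x 1\<bar>\<bar> - Lc / (1 + L) * \<bar>u' 1 - L * \<bar>x' 1\<bar>\<bar>\<bar>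
      \<le> Lc * (\<bar>x 1 - x' 1\<bar> + \<bar>u 1 - u' 1\<bar>)"
    by (simp only: scale)
  moreover have "0 \<le> Lc * (\<bar>x 1 - x' 1\<bar> + \<bar>u 1 - u' 1\<bar>)" using assms by simp
  ultimately show "\<bar>tight_cost Lc L t x u - tight_cost Lc L t x' u'\<bar>
     \<le> Lc * (norm1 (dim_x tight_system) (\<lambda>i. x i - x' i)
        + norm1 (dim_u tight_system) (\<lambda>j. u j - u' j))"
    unfolding tight_system_simps N tight_cost_def by simp
qed

lemma ambiguity_set_dirac:
  assumes "X \<noteq> {}" "\<And>x. x \<in> X \<Longrightarrow> \<bar>x\<bar> \<le> 1"
  shows "ambiguity_set tight_system (\<lambda>_ _. -1) (\<lambda>_ _. 1) (dirac ` X)"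
  unfolding ambiguity_set_def
proof (intro conjI ballI)
  show "dirac ` X \<noteq> {}" using assms(1) by simp
  fix P assume "P \<in> dirac ` X"
  then obtain x where x: "x \<in> X" "P = dirac x" by blast
  show "sets P = sets (restrict_space (PiM (hist_index tight_system (horizon tight_system)) (\<lambda>_. borel))
      (cube (horizon tight_system)))"
    by (simp add: x dirac_def)
  show "prob_space P"
    unfolding x dirac_def
    by (rule prob_space_return)
      (simp add: space_of_support_measure[OF refl] scenario_in_cube assms(2)[OF x(1)])
qed

lemma integral_dirac:
  assumes Lc: "0 < Lc" and L: "0 < L" and x: "\<bar>x\<bar> \<le> 1"
    and \<pi>: "\<pi> \<in> lipschitz_policies tight_system (\<lambda>_ _. -1) (\<lambda>_ _. 1) L"
  shows "(\<integral>\<xi>. total_cost tight_system (\<lambda>_. 0) (\<lambda>_. 1) (tight_cost Lc L) \<pi> \<xi> \<partial>dirac x)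
    = Lc / (1 + L) * \<bar>\<pi> 2 (scenario x) 1 - L * \<bar>x\<bar>\<bar>"
proof -
  let ?F = "total_cost tight_system (\<lambda>_. 0) (\<lambda>_. 1) (tight_cost Lc L) \<pi>"
  let ?M = "restrict_space (PiM (hist_index tight_system 2) (\<lambda>_. borel)) (cube 2)"
  obtain K where K: "\<And>\<xi> \<xi>'. \<xi> \<in> cube 2 \<Longrightarrow> \<xi>' \<in> cube 2 \<Longrightarrow>
      \<bar>?F \<xi> - ?F \<xi>'\<bar> \<le> K * (\<Sum>z\<in>hist_index tight_system 2. \<bar>\<xi> z - \<xi>' z\<bar>)"
    by (rule total_cost_lipschitz[OF _ lipschitz_tight_cost[OF Lc L] _ \<pi>, of "\<lambda>_. 1" "\<lambda>_. 0"])
      (use Lc L in auto)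
  have "?F \<in> borel_measurable ?M"
    using K by (rule measurable_lipschitz_on_support)
  moreover have "scenario x \<in> space ?M"
    by (simp add: space_of_support_measure[OF refl] scenario_in_cube x)
  ultimately have "(\<integral>\<xi>. ?F \<xi> \<partial>dirac x) = ?F (scenario x)"
    unfolding dirac_def by (intro integral_return) auto
  then show ?thesis by (simp only: tight_total_cost[OF scenario_in_cube[OF x]] scenario_1)
qed

lemma breakpoints_grid:
  "1 \<le> n \<Longrightarrow> breakpoints tight_system (\<lambda>_ _. -1) (\<lambda>_ _. 1) (\<lambda>_ _. n) (grid n)"
  by (auto simp: breakpoints_def grid_def divide_right_mono)

lemma largest_segment_grid:
  assumes "1 \<le> n"
  shows "largest_segment tight_system (\<lambda>_ _. n) (grid n) = 2 / real n"
proof (rule antisym)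
  have step: "grid n t i k - grid n t i (k - 1) = 2 / real n" if "k \<in> {1..n}" for t i k
    using that by (cases k) (auto simp: grid_def diff_divide_distrib[symmetric])
  show "largest_segment tight_system (\<lambda>_ _. n) (grid n) \<le> 2 / real n"
    using step by (intro largest_segment_least[OF _ breakpoints_grid[OF assms]])
      (auto simp: wf_system_def)
  show "2 / real n \<le> largest_segment tight_system (\<lambda>_ _. n) (grid n)"
    using largest_segment_upper[of 1 tight_system 1 1 "\<lambda>_ _. n" "grid n"] step[of 1 1 1] assms
    by simp
qed

text \<open>
  For \<open>n = 2 * N + 1\<close> the segment number \<open>N + 1\<close> is \<open>{-1/n..1/n}\<close>, and a lifted policy is affine on
  it in the first disturbance while the second one stays at \<open>0\<close>.
\<close>

lemma lifted_policy_affine_at_midpoint: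
  assumes n: "n = 2 * N + 1"
    and \<pi>: "\<pi> \<in> lifted_policies tight_system (\<lambda>_ _. -1) (\<lambda>_ _. 1) (\<lambda>_ _. n) (grid n)"
  shows "\<pi> 2 (scenario (1 / real n)) 1 + \<pi> 2 (scenario (- (1 / real n))) 1
    = 2 * \<pi> 2 (scenario 0) 1"
proof -
  obtain Y y where Y: "\<And>\<xi>. \<xi> \<in> cube 2 \<Longrightarrow>
      \<pi> 2 \<xi> 1 = lifted_component tight_system (\<lambda>_ _. n) (grid n) 2 Y y \<xi>"
    using \<pi> unfolding lifted_policies_iff by fastforce
  let ?g = "lifted_sum (grid n) 1 1 n (\<lambda>k. Y (1, 1, k))"
  define c where "c = lifted_sum (grid n) 2 1 n (\<lambda>k. Y (2, 1, k)) 0 + y"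
  have comp: "\<pi> 2 (scenario x) 1 = ?g x + c" if "\<bar>x\<bar> \<le> 1" for x
    unfolding Y[OF scenario_in_cube[OF that]] lifted_component_hist_index hist_index_tight c_def
    by (simp add: scenario_def hist_index_tight)
  have ord: "nodes_ordered (grid n) 1 1 n"
    by (simp add: nodes_ordered_def grid_def divide_right_mono)
  have ends: "grid n 1 1 N = - (1 / real n)" "grid n 1 1 (Suc N) = 1 / real n"
    using n by (simp_all add: grid_def field_simps)
  have aff: "?g x = ?g (- (1 / real n)) + Y (1, 1, Suc N) * (x + 1 / real n)"
    if "- (1 / real n) \<le> x" "x \<le> 1 / real n" for x
    using lifted_sum_on_segment[OF ord, of "Suc N" x "\<lambda>k. Y (1, 1, k)"] ends that n by simp
  have "?g (1 / real n) + ?g (- (1 / real n)) = 2 * ?g 0"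
    using aff[of 0] aff[of "1 / real n"] by (simp add: algebra_simps)
  moreover have "\<bar>1 / real n\<bar> \<le> 1" using n by simp
  ultimately show ?thesis using comp[of "1 / real n"] comp[of "- (1 / real n)"] comp[of 0] by simp
qed

lemma tight_policy_ball:
  assumes "\<And>\<xi>. \<pi> 1 \<xi> 1 = 0" "\<And>\<xi>. \<xi> \<in> cube 2 \<Longrightarrow> \<bar>\<pi> 2 \<xi> 1\<bar> \<le> L"
  shows "\<pi> \<in> policy_ball tight_system (\<lambda>_ _. -1) (\<lambda>_ _. 1) (\<lambda>_ _ _. 0) L"
proof -
  have "(SUP \<xi>\<in>cube 1. ereal \<bar>\<pi> 1 \<xi> 1 - 0\<bar>) \<le> 0"
    using assms(1) by (intro SUP_least) simp
  moreover have "(SUP \<xi>\<in>cube 2. ereal \<bar>\<pi> 2 \<xi> 1 - 0\<bar>) \<le> ereal L"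
    using assms(2) by (intro SUP_least) simp
  ultimately have "(SUP \<xi>\<in>cube 1. ereal \<bar>\<pi> 1 \<xi> 1 - 0\<bar>) + (SUP \<xi>\<in>cube 2. ereal \<bar>\<pi> 2 \<xi> 1 - 0\<bar>)
      \<le> 0 + ereal L"
    by (rule add_mono)
  then show ?thesis
    unfolding policy_ball_def policy_dist_def tight_system_simps tight_indices by simp
qed

text \<open>
  If the errors at the two ends of the middle segment were below \<open>L / (2 * n)\<close>, both controls there would
  exceed \<open>L / n - L / (2 * n)\<close>; their mean, the control at \<open>0\<close>, would exceed \<open>L / (2 * n)\<close>, where the
  target is \<open>0\<close>.  The radius \<open>L\<close> around the zero policy is large enough to contain the target policy,
  which never exceeds \<open>L\<close> on the support.
\<close>

lemma tight_instance:
  assumes Lc: "0 < Lc" and L: "0 < L" and n: "n = 2 * N + 1"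
  defines "X \<equiv> {- (1 / real n), 0, 1 / real n}"
  defines "VL \<equiv> value_lifted tight_system (\<lambda>_ _. -1) (\<lambda>_ _. 1) (\<lambda>_. 0) (\<lambda>_. 1) (tight_cost Lc L)
      (dirac ` X) (\<lambda>_ _ _. 0) L (\<lambda>_ _. n) (grid n) L"
    and "VA \<equiv> value_additive tight_system (\<lambda>_ _. -1) (\<lambda>_ _. 1) (\<lambda>_. 0) (\<lambda>_. 1) (tight_cost Lc L)
      (dirac ` X) (\<lambda>_ _ _. 0) L L"
  shows "hypotheses tight_system (\<lambda>_ _. -1) (\<lambda>_ _. 1) (\<lambda>_. 1) Lc (tight_cost Lc L)
      (dirac ` X) (\<lambda>_ _ _. 0) L (\<lambda>_ _. n) (grid n)"
    and "VA = 0" and "VL \<le> ereal Lc" and "ereal (Lc / (1 + L) * (L / (2 * real n))) \<le> VL"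
proof -
  have n1: "1 \<le> n" using n by simp
  have X: "\<bar>x\<bar> \<le> 1" if "x \<in> X" for x using that n by (auto simp: X_def)
  let ?lip = "lipschitz_policies tight_system (\<lambda>_ _. -1) (\<lambda>_ _. 1) L"
  let ?ball = "policy_ball tight_system (\<lambda>_ _. -1) (\<lambda>_ _. 1) (\<lambda>_ _ _. 0) L"
  let ?lifted = "lifted_policies tight_system (\<lambda>_ _. -1) (\<lambda>_ _. 1) (\<lambda>_ _. n) (grid n)"
  let ?add = "additive_policies tight_system (\<lambda>_ _. -1) (\<lambda>_ _. 1)"
  let ?J = "\<lambda>\<pi>. SUP P\<in>dirac ` X. ereal (\<integral>\<xi>. total_cost tight_system (\<lambda>_. 0) (\<lambda>_. 1) (tight_cost Lc L) \<pi> \<xi> \<partial>P)"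
  have J: "?J \<pi> = (SUP x\<in>X. ereal (Lc / (1 + L) * \<bar>\<pi> 2 (scenario x) 1 - L * \<bar>x\<bar>\<bar>))"
    if "\<pi> \<in> ?lip" for \<pi>
    unfolding image_image
    by (intro SUP_cong refl) (simp add: integral_dirac[OF Lc L X that])
  have zero: "(\<lambda>_ _ _. 0) \<in> ?lifted"
    unfolding lifted_policies_iff
    by (rule exI[of _ "\<lambda>_ _ _. 0"], rule exI[of _ "\<lambda>_ _. 0"]) (simp add: lifted_component_def)
  show "hypotheses tight_system (\<lambda>_ _. -1) (\<lambda>_ _. 1) (\<lambda>_. 1) Lc (tight_cost Lc L)
      (dirac ` X) (\<lambda>_ _ _. 0) L (\<lambda>_ _. n) (grid n)"
    unfolding hypotheses_def
    using zero L breakpoints_grid[OF n1] lipschitz_tight_cost[OF Lc L] ambiguity_set_dirac[of X, OF _ X]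
    by (simp add: wf_system_def wf_support_def X_def)
  have k: "0 < Lc / (1 + L)" using Lc L by simp
  show "VA = 0"
  proof (rule antisym)
    define \<pi> :: policy where "\<pi> t \<xi> j = (if t = 2 then L * \<bar>\<xi> (1, 1)\<bar> else 0)" for t \<xi> j
    have "\<pi> \<in> ?add"
      unfolding additive_policies_def mem_Collect_eq tight_system_simps
    proof (intro ballI)
      fix t j :: nat assume "t \<in> {1..2}" "j \<in> {1..1}"
      show "\<exists>f :: nat \<Rightarrow> nat \<Rightarrow> real \<Rightarrow> real.
        (\<forall>t'\<in>{1..t}. \<forall>i\<in>{1..1}. continuous_on {- 1..1} (f t' i)) \<and>
        (\<forall>\<xi>\<in>cube t. \<pi> t \<xi> j = (\<Sum>t'=1..t. \<Sum>i=1..1. f t' i (\<xi> (t', i))))"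
        using \<open>t \<in> {1..2}\<close> unfolding tight_indices
        by (intro exI[of _ "\<lambda>t' i x. if t = 2 \<and> t' = 1 then L * \<bar>x\<bar> else 0"])
          (auto simp: \<pi>_def tight_indices[simplified] intro!: continuous_intros)
    qed
    moreover have lip: "\<pi> \<in> ?lip"
      unfolding lipschitz_policies_def mem_Collect_eq
    proof (intro ballI)
      fix t j \<xi> \<xi>' assume t: "t \<in> {1..horizon tight_system}"
      have "\<bar>\<pi> t \<xi> j - \<pi> t \<xi>' j\<bar> \<le> L * (if t = 2 then \<bar>\<xi> (1, 1) - \<xi>' (1, 1)\<bar> else 0)"
        using L abs_triangle_ineq3[of "\<xi> (1, 1)" "\<xi>' (1, 1)"]
        by (simp add: \<pi>_def right_diff_distrib[symmetric] abs_mult)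
      also have "\<dots> \<le> L * (\<Sum>z\<in>hist_index tight_system t. \<bar>\<xi> z - \<xi>' z\<bar>)"
        using L by (intro mult_left_mono) (auto simp: hist_index_tight sum_nonneg)
      finally show "\<bar>\<pi> t \<xi> j - \<pi> t \<xi>' j\<bar> \<le> L * (\<Sum>z\<in>hist_index tight_system t. \<bar>\<xi> z - \<xi>' z\<bar>)" .
    qed
    moreover have "\<pi> \<in> ?ball"
    proof (rule tight_policy_ball)
      fix \<xi> assume "\<xi> \<in> cube 2"
      then have "\<bar>\<xi> (1, 1)\<bar> \<le> 1" by (auto simp: hist_support_iff hist_index_tight)
      then have "L * \<bar>\<xi> (1, 1)\<bar> \<le> L * 1" using L by (intro mult_left_mono) auto
      then show "\<bar>\<pi> 2 \<xi> 1\<bar> \<le> L" using L by (simp add: \<pi>_def abs_mult)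
    qed (simp add: \<pi>_def)
    ultimately have "VA \<le> ?J \<pi>"
      unfolding VA_def value_additive_def optimal_value_total_cost by (auto intro!: INF_lower)
    also have "?J \<pi> = (SUP x\<in>X. 0)"
      unfolding J[OF lip] by (intro SUP_cong refl) (simp add: \<pi>_def scenario_1[simplified])
    also have "\<dots> = 0" by (simp add: X_def)
    finally show "VA \<le> 0" .
    show "0 \<le> VA"
      unfolding VA_def value_additive_def optimal_value_total_cost
    proof (rule INF_greatest)
      fix \<pi> assume "\<pi> \<in> ?add \<inter> ?lip \<inter> ?ball"
      then have "?J \<pi> = (SUP x\<in>X. ereal (Lc / (1 + L) * \<bar>\<pi> 2 (scenario x) 1 - L * \<bar>x\<bar>\<bar>))"
        by (intro J) simp
      also have "0 \<le> \<dots>"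
        using Lc L by (intro SUP_upper2[of 0]) (auto simp: X_def)
      finally show "0 \<le> ?J \<pi>" .
    qed
  qed
  show "VL \<le> ereal Lc"
  proof -
    have lip: "(\<lambda>_ _ _. 0) \<in> ?lip" using L by (simp add: lipschitz_policies_def sum_nonneg)
    moreover have "(\<lambda>_ _ _. 0) \<in> ?ball" using L by (intro tight_policy_ball) auto
    ultimately have "VL \<le> ?J (\<lambda>_ _ _. 0)"
      unfolding VL_def value_lifted_def optimal_value_total_cost using zero
      by (intro INF_lower) simp
    also have "\<dots> \<le> ereal Lc"
      unfolding J[OF lip]
    proof (rule SUP_least)
      fix x assume x: "x \<in> X"
      have "L * \<bar>x\<bar> \<le> L * 1" "0 \<le> L * \<bar>x\<bar>" using X[OF x] L by (auto intro: mult_left_mono)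
      then have "\<bar>0 - L * \<bar>x\<bar>\<bar> \<le> 1 + L" using L by linarith
      then have "Lc / (1 + L) * \<bar>0 - L * \<bar>x\<bar>\<bar> \<le> Lc / (1 + L) * (1 + L)"
        using k by (intro mult_left_mono) auto
      then show "ereal (Lc / (1 + L) * \<bar>0 - L * \<bar>x\<bar>\<bar>) \<le> ereal Lc" using L by simp
    qed
    finally show ?thesis .
  qed
  show "ereal (Lc / (1 + L) * (L / (2 * real n))) \<le> VL"
    unfolding VL_def value_lifted_def optimal_value_total_cost
  proof (rule INF_greatest)
    fix \<pi> assume \<pi>: "\<pi> \<in> ?lifted \<inter> ?lip \<inter> ?ball"
    let ?e = "\<lambda>x. \<bar>\<pi> 2 (scenario x) 1 - L * \<bar>x\<bar>\<bar>"
    have "\<pi> 2 (scenario (1 / real n)) 1 + \<pi> 2 (scenario (- (1 / real n))) 1 = 2 * \<pi> 2 (scenario 0) 1"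
      using \<pi> by (intro lifted_policy_affine_at_midpoint[OF n]) simp
    moreover have "L / real n = 2 * (L / (2 * real n))" by simp
    moreover have "L * \<bar>1 / real n\<bar> = L / real n" "L * \<bar>- (1 / real n)\<bar> = L / real n" by simp_all
    ultimately have "L / (2 * real n) \<le> ?e (- (1 / real n)) \<or> L / (2 * real n) \<le> ?e 0 \<or>
        L / (2 * real n) \<le> ?e (1 / real n)"
      by (simp only: abs_zero mult_zero_right) linarith
    then obtain x where x: "x \<in> X" "L / (2 * real n) \<le> ?e x"
      unfolding X_def by blast
    have "ereal (Lc / (1 + L) * (L / (2 * real n))) \<le> ereal (Lc / (1 + L) * ?e x)"
      using mult_left_mono[OF x(2) less_imp_le[OF k]] by simp
    also have "\<dots> \<le> (SUP x\<in>X. ereal (Lc / (1 + L) * ?e x))" by (rule SUP_upper[OF x(1)])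
    also have "\<dots> = ?J \<pi>" using \<pi> by (intro J[symmetric]) simp
    finally show "ereal (Lc / (1 + L) * (L / (2 * real n))) \<le> ?J \<pi>" .
  qed
qed

theorem theorem2:
  shows
    "(\<forall>S Lc L\<pi>. wf_system S \<and> 0 \<le> Lc \<and> 0 \<le> L\<pi> \<longrightarrow>
        (\<exists>C. \<forall>l v x0 \<alpha> c \<B> \<pi>0 \<rho> p w. hypotheses S l v \<alpha> Lc c \<B> \<pi>0 \<rho> p w \<longrightarrow>
           value_lifted S l v x0 \<alpha> c \<B> \<pi>0 \<rho> p w L\<pi>
             \<le> value_additive S l v x0 \<alpha> c \<B> \<pi>0 \<rho> L\<pi> + ereal (C * largest_segment S p w)))
   \<and> (\<forall>Lc L\<pi>. 0 < Lc \<and> 0 < L\<pi> \<longrightarrow>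
        (\<exists>S l v x0 \<alpha>. \<exists>\<kappa>>0. \<forall>\<delta>>0. \<exists>\<epsilon>. 0 < \<epsilon> \<and> \<epsilon> < \<delta> \<and>
           (\<exists>p w \<pi>0 \<rho> \<B> c. hypotheses S l v \<alpha> Lc c \<B> \<pi>0 \<rho> p w \<and>
              largest_segment S p w = \<epsilon> \<and>
              \<bar>value_lifted S l v x0 \<alpha> c \<B> \<pi>0 \<rho> p w L\<pi>\<bar> \<noteq> \<infinity> \<and>
              \<bar>value_additive S l v x0 \<alpha> c \<B> \<pi>0 \<rho> L\<pi>\<bar> \<noteq> \<infinity> \<and>
              value_lifted S l v x0 \<alpha> c \<B> \<pi>0 \<rho> p w L\<pi>
                - value_additive S l v x0 \<alpha> c \<B> \<pi>0 \<rho> L\<pi> \<ge> ereal (\<kappa> * \<epsilon>))))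
   \<and> (\<forall>S l v Lc L\<pi>. wf_system S \<and> wf_support S l v \<and> 0 \<le> Lc \<and> 0 \<le> L\<pi> \<longrightarrow>
        (\<exists>C1 C2. \<forall>n\<ge>1. \<forall>p w. breakpoints S l v p w \<and> equal_segments S l v n p w \<longrightarrow>
           largest_segment S p w \<le> C1 / real n \<and>
           (\<forall>x0 \<alpha> c \<B> \<pi>0 \<rho>. hypotheses S l v \<alpha> Lc c \<B> \<pi>0 \<rho> p w \<longrightarrow>
              value_lifted S l v x0 \<alpha> c \<B> \<pi>0 \<rho> p w L\<pi>
                \<le> value_additive S l v x0 \<alpha> c \<B> \<pi>0 \<rho> L\<pi> + ereal (C2 / real n))))"
proof (intro conjI allI impI)
  fix S :: lin_system and Lc L\<pi> :: real
  assume "wf_system S \<and> 0 \<le> Lc \<and> 0 \<le> L\<pi>"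
  then have "\<exists>C\<ge>0. \<forall>l v x0 \<alpha> c \<B> \<pi>0 \<rho> p w. hypotheses S l v \<alpha> Lc c \<B> \<pi>0 \<rho> p w \<longrightarrow>
       value_lifted S l v x0 \<alpha> c \<B> \<pi>0 \<rho> p w L\<pi>
         \<le> value_additive S l v x0 \<alpha> c \<B> \<pi>0 \<rho> L\<pi> + ereal (C * largest_segment S p w)"
    by (intro value_lifted_le_value_additive) simp_all
  then show "\<exists>C. \<forall>l v x0 \<alpha> c \<B> \<pi>0 \<rho> p w. hypotheses S l v \<alpha> Lc c \<B> \<pi>0 \<rho> p w \<longrightarrow>
           value_lifted S l v x0 \<alpha> c \<B> \<pi>0 \<rho> p w L\<pi>
             \<le> value_additive S l v x0 \<alpha> c \<B> \<pi>0 \<rho> L\<pi> + ereal (C * largest_segment S p w)"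
    by (elim exE conjE) (rule exI)
next
  fix Lc L\<pi> :: real
  assume "0 < Lc \<and> 0 < L\<pi>"
  then have Lc: "0 < Lc" and L: "0 < L\<pi>" by simp_all
  define \<kappa> where "\<kappa> = Lc / (1 + L\<pi>) * (L\<pi> / 4)"
  have \<kappa>: "0 < \<kappa>" using Lc L by (simp add: \<kappa>_def)
  have "\<exists>\<epsilon>. 0 < \<epsilon> \<and> \<epsilon> < \<delta> \<and>
           (\<exists>p w \<pi>0 \<rho> \<B> c. hypotheses tight_system (\<lambda>_ _. -1) (\<lambda>_ _. 1) (\<lambda>_. 1) Lc c \<B> \<pi>0 \<rho> p w \<and>
              largest_segment tight_system p w = \<epsilon> \<and>
              \<bar>value_lifted tight_system (\<lambda>_ _. -1) (\<lambda>_ _. 1) (\<lambda>_. 0) (\<lambda>_. 1) c \<B> \<pi>0 \<rho> p w L\<pi>\<bar> \<noteq> \<infinity> \<and>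
              \<bar>value_additive tight_system (\<lambda>_ _. -1) (\<lambda>_ _. 1) (\<lambda>_. 0) (\<lambda>_. 1) c \<B> \<pi>0 \<rho> L\<pi>\<bar> \<noteq> \<infinity> \<and>
              value_lifted tight_system (\<lambda>_ _. -1) (\<lambda>_ _. 1) (\<lambda>_. 0) (\<lambda>_. 1) c \<B> \<pi>0 \<rho> p w L\<pi>
                - value_additive tight_system (\<lambda>_ _. -1) (\<lambda>_ _. 1) (\<lambda>_. 0) (\<lambda>_. 1) c \<B> \<pi>0 \<rho> L\<pi>
                \<ge> ereal (\<kappa> * \<epsilon>))"
    if \<delta>: "0 < \<delta>" for \<delta>
  proof -
    \<comment> \<open>An odd number of segments places the kink of the target at a midpoint.\<close>
    obtain N :: nat where N: "1 / \<delta> < real N" using reals_Archimedean2 by blast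
    define n where "n = 2 * N + 1"
    have "2 / real n < \<delta>"
    proof -
      have "1 < \<delta> * real N" using N \<delta> by (simp add: field_simps)
      then have "2 < \<delta> * real n" using \<delta> by (simp add: n_def algebra_simps)
      then show ?thesis by (simp add: n_def field_simps)
    qed
    moreover have "0 < 2 / real n" "1 \<le> n" by (simp_all add: n_def)
    moreover note T = tight_instance[OF Lc L n_def]
    let ?\<B> = "dirac ` {- (1 / real n), 0, 1 / real n}"
    let ?VL = "value_lifted tight_system (\<lambda>_ _. -1) (\<lambda>_ _. 1) (\<lambda>_. 0) (\<lambda>_. 1) (tight_cost Lc L\<pi>)
      ?\<B> (\<lambda>_ _ _. 0) L\<pi> (\<lambda>_ _. n) (grid n) L\<pi>"
    have "L\<pi> / 4 * (2 / real n) = L\<pi> / (2 * real n)" by simp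
    then have "\<kappa> * (2 / real n) = Lc / (1 + L\<pi>) * (L\<pi> / (2 * real n))"
      by (simp only: \<kappa>_def mult.assoc)
    then have low: "ereal (\<kappa> * (2 / real n)) \<le> ?VL" using T(4) by (simp only:)
    moreover have "\<bar>?VL\<bar> \<noteq> \<infinity>"
    proof -
      have "-\<infinity> < ?VL" using low by (rule less_le_trans[rotated]) simp
      moreover have "?VL < \<infinity>" using T(3) by (rule le_less_trans) simp
      ultimately show ?thesis by auto
    qed
    ultimately show ?thesis
      using T(1,2) largest_segment_grid[of n]
      by - (rule exI[of _ "2 / real n"], intro conjI, assumption, assumption,
          rule exI[of _ "\<lambda>_ _. n"], rule exI[of _ "grid n"], rule exI[of _ "\<lambda>_ _ _. 0"],
          rule exI[of _ L\<pi>], rule exI[of _ ?\<B>], rule exI[of _ "tight_cost Lc L\<pi>"], simp)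
  qed
  with \<kappa> show "\<exists>S l v x0 \<alpha>. \<exists>\<kappa>>0. \<forall>\<delta>>0. \<exists>\<epsilon>. 0 < \<epsilon> \<and> \<epsilon> < \<delta> \<and>
           (\<exists>p w \<pi>0 \<rho> \<B> c. hypotheses S l v \<alpha> Lc c \<B> \<pi>0 \<rho> p w \<and>
              largest_segment S p w = \<epsilon> \<and>
              \<bar>value_lifted S l v x0 \<alpha> c \<B> \<pi>0 \<rho> p w L\<pi>\<bar> \<noteq> \<infinity> \<and>
              \<bar>value_additive S l v x0 \<alpha> c \<B> \<pi>0 \<rho> L\<pi>\<bar> \<noteq> \<infinity> \<and>
              value_lifted S l v x0 \<alpha> c \<B> \<pi>0 \<rho> p w L\<pi>
                - value_additive S l v x0 \<alpha> c \<B> \<pi>0 \<rho> L\<pi> \<ge> ereal (\<kappa> * \<epsilon>))"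
    by - (rule exI[of _ tight_system], rule exI[of _ "\<lambda>_ _. -1"], rule exI[of _ "\<lambda>_ _. 1"],
      rule exI[of _ "\<lambda>_. 0"], rule exI[of _ "\<lambda>_. 1"], rule exI[of _ \<kappa>], intro conjI allI impI)
next
  fix S :: lin_system and l v :: "nat \<Rightarrow> nat \<Rightarrow> real" and Lc L\<pi> :: real
  assume A: "wf_system S \<and> wf_support S l v \<and> 0 \<le> Lc \<and> 0 \<le> L\<pi>"
  then have S: "wf_system S" "wf_support S l v" by simp_all
  have "\<exists>C\<ge>0. \<forall>l v x0 \<alpha> c \<B> \<pi>0 \<rho> p w. hypotheses S l v \<alpha> Lc c \<B> \<pi>0 \<rho> p w \<longrightarrow>
       value_lifted S l v x0 \<alpha> c \<B> \<pi>0 \<rho> p w L\<pi>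
         \<le> value_additive S l v x0 \<alpha> c \<B> \<pi>0 \<rho> L\<pi> + ereal (C * largest_segment S p w)"
    using A by (intro value_lifted_le_value_additive) simp_all
  then obtain C where C: "0 \<le> C"
    "\<forall>l v x0 \<alpha> c \<B> \<pi>0 \<rho> p w. hypotheses S l v \<alpha> Lc c \<B> \<pi>0 \<rho> p w \<longrightarrow>
       value_lifted S l v x0 \<alpha> c \<B> \<pi>0 \<rho> p w L\<pi>
         \<le> value_additive S l v x0 \<alpha> c \<B> \<pi>0 \<rho> L\<pi> + ereal (C * largest_segment S p w)"
    by (elim exE conjE)
  define C1 where "C1 = (\<Sum>z\<in>hist_index S (horizon S). v (fst z) (snd z) - l (fst z) (snd z))"
  show "\<exists>C1 C2. \<forall>n\<ge>1. \<forall>p w. breakpoints S l v p w \<and> equal_segments S l v n p w \<longrightarrow>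
           largest_segment S p w \<le> C1 / real n \<and>
           (\<forall>x0 \<alpha> c \<B> \<pi>0 \<rho>. hypotheses S l v \<alpha> Lc c \<B> \<pi>0 \<rho> p w \<longrightarrow>
              value_lifted S l v x0 \<alpha> c \<B> \<pi>0 \<rho> p w L\<pi>
                \<le> value_additive S l v x0 \<alpha> c \<B> \<pi>0 \<rho> L\<pi> + ereal (C2 / real n))"
  proof (rule exI[of _ C1], rule exI[of _ "C * C1"], intro allI impI, elim conjE, intro conjI allI impI)
    fix n p w assume n: "1 \<le> n" and bp: "breakpoints S l v p w" "equal_segments S l v n p w"
    show seg: "largest_segment S p w \<le> C1 / real n"
      unfolding C1_def by (rule largest_segment_equal_segments[OF S n bp])
    fix x0 \<alpha> c \<B> \<pi>0 \<rho> assume H: "hypotheses S l v \<alpha> Lc c \<B> \<pi>0 \<rho> p w"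
    have "ereal (C * largest_segment S p w) \<le> ereal (C * C1 / real n)"
      using mult_left_mono[OF seg C(1)] by simp
    then show "value_lifted S l v x0 \<alpha> c \<B> \<pi>0 \<rho> p w L\<pi>
        \<le> value_additive S l v x0 \<alpha> c \<B> \<pi>0 \<rho> L\<pi> + ereal (C * C1 / real n)"
      by (intro order_trans[OF C(2)[rule_format, OF H]] add_left_mono)
  qed
qed

end
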